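(* Let $\Gamma$ be a finite abelian group and let $S\subseteq\Gamma$ with $0\notin S$. Then the mixed Cayley graph $\mathrm{Cay}(\Gamma,S)$ is HS-integral if and only if $S\setminus\overline{S}\in\mathbb{B}(\Gamma)$ and $\overline{S}\in\mathbb{E}(\Gamma)$.
   Context: $\Gamma$ is written additively, with identity $0$; for $x\in\Gamma$ and $k\in\mathbb{Z}$, $x^k$ denotes $kx$, and $-x$ is the inverse of $x$. For $S\subseteq\Gamma$ with $0\notin S$, put $S^{-1}=\{-s:s\in S\}$ and $\overline{S}=\{u\in S: -u\notin S\}$. A set $S$ is skew-symmetric if $-a\notin S$ for all $a\in S$. The mixed Cayley graph $\mathrm{Cay}(\Gamma,S)$ has vertex set $\Gamma$ and arc set $\{(a,b): b-a\in S\}$. For a mixed graph $G$, the Hermitian adjacency matrix of second kind $\mathcal{H}(G)=(h_{uv})$ is defined by $h_{uv}=1$ if both $(u,v)$ and $(v,u)$ are arcs, $h_{uv}=\frac{1+i\sqrt3}{2}$ if $(u,v)$ is an arc and $(v,u)$ is not, $h_{uv}=\frac{1-i\sqrt3}{2}$ if $(v,u)$ is an arc and $(u,v)$ is not, and $h_{uv}=0$ otherwise. $G$ is HS-integral if all eigenvalues of $\mathcal{H}(G)$ are integers. A simple graph, i.e. one with $S$ symmetric, is integral if all its adjacency eigenvalues are integers. $\mathbb{B}(\Gamma)$ is the Boolean algebra of subsets of $\Gamma$ generated by all subgroups of $\Gamma$ under finite unions, intersections and complements. Its atoms are the sets $[x]=\{y\in\Gamma:\langle y\rangle=\langle x\rangle\}$,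 and every element of $\mathbb{B}(\Gamma)$ is a union of such atoms. $\Gamma(3)$ is the set of $x\in\Gamma$ whose order is divisible by $3$. For $m\equiv0\pmod 3$, put $G^1_{m,3}(1)=\{k:1\le k\le m-1,\ \gcd(k,m)=1,\ k\equiv1\pmod3\}$. For $x\in\Gamma(3)$ with $\mathrm{ord}(x)=m$, put $\langle\!\langle x\rangle\!\rangle=\{x^k:k\in G^1_{m,3}(1)\}$. If $\Gamma(3)\neq\emptyset$, $\mathbb{E}(\Gamma)$ is the set of all skew-symmetric subsets of $\Gamma$ of the form $\langle\!\langle x_1\rangle\!\rangle\cup\cdots\cup\langle\!\langle x_k\rangle\!\rangle$ with $x_1,\dots,x_k\in\Gamma(3)$. If $\Gamma(3)=\emptyset$, then $\mathbb{E}(\Gamma)=\{\emptyset\}$. *)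

theory Defs
  imports
    Complex_Main
    "HOL-Algebra.Multiplicative_Group"
    "HOL-Number_Theory.Cong"
    "Graph_Theory.Pair_Digraph"
begin

text \<open>
  Groups are HOL-Algebra groups, hence written multiplicatively: \<open>b - a\<close> becomes
  \<open>b \<otimes> inv a\<close>, \<open>kx\<close> becomes \<open>x [^] k\<close> and \<open>0\<close> becomes \<open>\<one>\<close>.
\<close>

definition cayley_mixed_graph :: "('a, 'b) monoid_scheme \<Rightarrow> 'a set \<Rightarrow> 'a pair_pre_digraph" where
  "cayley_mixed_graph G S =
     \<lparr> pverts = carrier G,
       parcs = {(a, b). a \<in> carrier G \<and> b \<in> carrier G \<and> b \<otimes>\<^bsub>G\<^esub> inv\<^bsub>G\<^esub> a \<in> S} \<rparr>"

text \<open>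
  Matrices with rows and columns indexed by a finite vertex set \<open>V\<close> are functions of two
  arguments, of which only the values on \<open>V \<times> V\<close> matter; vectors likewise.
\<close>

definition hermitian_adjacency2 :: "'a pair_pre_digraph \<Rightarrow> 'a \<Rightarrow> 'a \<Rightarrow> complex" where
  "hermitian_adjacency2 D u v =
     (if (u, v) \<in> parcs D \<and> (v, u) \<in> parcs D then 1
      else if (u, v) \<in> parcs D \<and> (v, u) \<notin> parcs D then (1 + \<i> * complex_of_real (sqrt 3)) / 2
      else if (v, u) \<in> parcs D \<and> (u, v) \<notin> parcs D then (1 - \<i> * complex_of_real (sqrt 3)) / 2
      else 0)"

definition eigenvalue_on :: "'a set \<Rightarrow> ('a \<Rightarrow> 'a \<Rightarrow> complex) \<Rightarrow> complex \<Rightarrow> bool" where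
  "eigenvalue_on V M c \<longleftrightarrow>
     (\<exists>x. (\<exists>u\<in>V. x u \<noteq> 0) \<and> (\<forall>u\<in>V. (\<Sum>v\<in>V. M u v * x v) = c * x u))"

definition HS_integral :: "'a pair_pre_digraph \<Rightarrow> bool" where
  "HS_integral D \<longleftrightarrow>
     (\<forall>c. eigenvalue_on (pverts D) (hermitian_adjacency2 D) c \<longrightarrow> c \<in> \<int>)"

definition skew_part :: "('a, 'b) monoid_scheme \<Rightarrow> 'a set \<Rightarrow> 'a set" where
  "skew_part G S = {u \<in> S. inv\<^bsub>G\<^esub> u \<notin> S}"

definition skew_symmetric :: "('a, 'b) monoid_scheme \<Rightarrow> 'a set \<Rightarrow> bool" where
  "skew_symmetric G S \<longleftrightarrow> (\<forall>a\<in>S. inv\<^bsub>G\<^esub> a \<notin> S)"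

inductive_set subgroup_algebra :: "('a, 'b) monoid_scheme \<Rightarrow> 'a set set"
  for G :: "('a, 'b) monoid_scheme" where
  subgroup: "subgroup H G \<Longrightarrow> H \<in> subgroup_algebra G"
| compl: "A \<in> subgroup_algebra G \<Longrightarrow> carrier G - A \<in> subgroup_algebra G"
| union: "A \<in> subgroup_algebra G \<Longrightarrow> B \<in> subgroup_algebra G \<Longrightarrow> A \<union> B \<in> subgroup_algebra G"
| inter: "A \<in> subgroup_algebra G \<Longrightarrow> B \<in> subgroup_algebra G \<Longrightarrow> A \<inter> B \<in> subgroup_algebra G"

definition elements_order_dvd3 :: "('a, 'b) monoid_scheme \<Rightarrow> 'a set" where
  "elements_order_dvd3 G = {x \<in> carrier G. 3 dvd group.ord G x}"

definition units_1_mod_3 :: "nat \<Rightarrow> nat set" where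
  "units_1_mod_3 m = {k. 1 \<le> k \<and> k \<le> m - 1 \<and> gcd k m = 1 \<and> [k = 1] (mod 3)}"

definition class3 :: "('a, 'b) monoid_scheme \<Rightarrow> 'a \<Rightarrow> 'a set" where
  "class3 G x = {x [^]\<^bsub>G\<^esub> k | k. k \<in> units_1_mod_3 (group.ord G x)}"

text \<open>
  The empty union (\<open>X = {}\<close>) is allowed, so the empty set always belongs to the family.
\<close>

definition skew_class_unions :: "('a, 'b) monoid_scheme \<Rightarrow> 'a set set" where
  "skew_class_unions G =
     (if elements_order_dvd3 G = {} then {{}}
      else {A. skew_symmetric G A \<and>
               (\<exists>X. finite X \<and> X \<subseteq> elements_order_dvd3 G \<and> A = (\<Union>x\<in>X. class3 G x))})"

end

theory Submission
  imports Defs "HOL-Number_Theory.Number_Theory" "Jordan_Normal_Form.Char_Poly"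
begin

text \<open>
  The eigenvalues are the Fourier coefficients \<open>\<Sum> f s * \<chi> s\<close> of a weight function \<open>f\<close> on \<open>G\<close> with values
  in \<open>\<int>[\<omega>]\<close>, where \<open>\<omega>\<close> is a primitive cube root of unity. With \<open>N\<close> the group order, they are all
  integers iff \<open>f (s\<^sup>k) = \<sigma>\<^sub>k (f s)\<close> for all \<open>k\<close> coprime to \<open>3N\<close>, where \<open>\<sigma>\<^sub>k\<close> is the identity or complex
  conjugation according to \<open>k\<close> modulo 3.

  If \<open>f\<close> is equivariant, then averaging over \<open>k\<close> expresses an eigenvalue through Ramanujan sums, so it is
  a rational algebraic integer. Conversely, let \<open>p\<close> be a prime not dividing \<open>3N\<close>. For an integral
  eigenvalue \<open>\<lambda>\<close>, the congruences
  \<open>\<Sum> f (s\<^sup>p) * \<chi> (s\<^sup>p) = \<lambda> \<equiv> \<lambda>\<^sup>p \<equiv> \<Sum> \<sigma>\<^sub>p (f s) * \<chi> (s\<^sup>p)\<close> modulo \<open>p\<close>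
  and Fourier inversion show that \<open>p\<close> divides \<open>N * (f (s\<^sup>p) - \<sigma>\<^sub>p (f s))\<close>, which forces the difference to
  vanish if \<open>p\<close> is large. Every \<open>k\<close> coprime to \<open>3N\<close> is congruent modulo \<open>3N\<close> to a product of large
  primes; thus neither Galois theory nor Dirichlet's theorem on primes is needed. Finally, equivariance
  for \<open>k \<equiv> 1\<close> modulo 3 says that the symmetric part of \<open>S\<close> is a union of classes \<open>[x]\<close> and its skew
  part a union of classes \<open>\<langle>\<langle>x\<rangle>\<rangle>\<close>.
\<close>

hide_const (open) Polynomial.order

section \<open>Algebraic integers\<close>

interpretation int_module: Modules.module "\<lambda>(k::int) (x::'a::comm_ring_1). of_int k * x"
  by unfold_locales (simp_all add: algebra_simps)

lemma algebraic_int_eigenvalue_of_int_mat: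
  fixes x :: "'a::field_char_0"
  assumes A: "A \<in> carrier_mat n n" and x: "eigenvalue (map_mat of_int A) x"
  shows "algebraic_int x"
proof -
  have "poly (char_poly (map_mat of_int A)) x = 0"
    using x A by (simp add: eigenvalue_root_char_poly[where n = n])
  then have "poly (of_int_poly (char_poly A)) x = 0"
    using of_int_hom.char_poly_hom[OF A] by metis
  moreover have "lead_coeff (char_poly A) = 1"
    using degree_monic_char_poly[OF A] by simp
  ultimately show ?thesis
    unfolding algebraic_int_altdef_ipoly by blast
qed

lemma algebraic_int_if_stable_int_span:
  fixes x :: "'a::field_char_0"
  assumes B: "finite B" "b\<^sub>0 \<in> B" "b\<^sub>0 \<noteq> 0"
    and stable: "\<And>b. b \<in> B \<Longrightarrow> x * b \<in> int_module.span B"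
  shows "algebraic_int x"
proof -
  have "\<exists>u. x * b = (\<Sum>b'\<in>B. of_int (u b') * b')" if "b \<in> B" for b
    using stable[OF that] by (auto simp: int_module.span_finite[OF B(1)])
  then obtain u where u: "\<And>b. b \<in> B \<Longrightarrow> x * b = (\<Sum>b'\<in>B. of_int (u b b') * b')"
    by metis
  define n where "n = card B"
  obtain e where e: "bij_betw e {0..<n} B"
    using ex_bij_betw_nat_finite[OF B(1)] unfolding n_def by blast
  define A where "A = mat n n (\<lambda>(i, j). u (e i) (e j))"
  have A: "A \<in> carrier_mat n n" by (simp add: A_def)
  define v where "v = vec n e"
  have "map_mat of_int A *\<^sub>v v = x \<cdot>\<^sub>v v"
  proof (rule eq_vecI)
    fix i assume "i < dim_vec (x \<cdot>\<^sub>v v)"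
    then have i: "i < n" by (simp add: v_def)
    then have "e i \<in> B" using e by (auto simp: bij_betw_def)
    have "(map_mat of_int A *\<^sub>v v) $ i = (\<Sum>j\<in>{0..<n}. of_int (u (e i) (e j)) * e j)"
      using i by (simp add: A_def v_def scalar_prod_def)
    also have "\<dots> = x * e i"
      unfolding u[OF \<open>e i \<in> B\<close>] by (rule sum.reindex_bij_betw[OF e])
    finally show "(map_mat of_int A *\<^sub>v v) $ i = (x \<cdot>\<^sub>v v) $ i"
      using i by (simp add: v_def)
  qed (simp add: A_def v_def)
  moreover obtain i where "i < n" "e i = b\<^sub>0"
    using e B(2) by (force simp: bij_betw_def)
  then have "v \<noteq> 0\<^sub>v n"
    using B(3) by (metis index_vec index_zero_vec(1) v_def)
  ultimately have "eigenvalue (map_mat of_int A) x"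
    unfolding eigenvalue_def eigenvector_def by (intro exI[of _ v]) (simp add: A_def v_def)
  then show ?thesis
    by (rule algebraic_int_eigenvalue_of_int_mat[OF A])
qed

lemma ex_stable_int_span_if_algebraic_int:
  fixes x :: "'a::field_char_0"
  assumes "algebraic_int x"
  obtains B where "finite B" "1 \<in> B" "\<And>b. b \<in> B \<Longrightarrow> x * b \<in> int_module.span B"
proof -
  obtain p where p: "poly (map_poly of_int p) x = 0" "lead_coeff p = 1"
    using assms unfolding algebraic_int_altdef_ipoly by blast
  define m where "m = degree p"
  have "m > 0"
    using p by (intro Nat.gr0I) (auto simp: m_def elim!: degree_eq_zeroE)
  define B where "B = (\<lambda>i. x ^ i) ` {..<m}"
  have "(\<Sum>i\<le>m. of_int (coeff p i) * x ^ i) = 0"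
    using p(1) by (simp add: poly_altdef m_def degree_map_poly coeff_map_poly)
  then have "x ^ m = (\<Sum>i<m. of_int (- coeff p i) * x ^ i)"
    using p(2) by (simp add: lessThan_Suc_atMost[symmetric] m_def sum_negf add_eq_0_iff)
  also have "\<dots> \<in> int_module.span B"
    by (intro int_module.span_sum int_module.span_scale int_module.span_base) (auto simp: B_def)
  finally have x_m: "x ^ m \<in> int_module.span B" .
  show thesis
  proof
    show "finite B" by (simp add: B_def)
    show "1 \<in> B" using \<open>m > 0\<close> by (force simp: B_def)
    fix b assume "b \<in> B"
    then obtain i where "i < m" "b = x ^ i" by (auto simp: B_def)
    then consider "Suc i < m" "x * b = x ^ Suc i" | "x * b = x ^ m"
      by (metis Suc_lessI power_Suc)
    then show "x * b \<in> int_module.span B"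
      by cases (auto simp: B_def x_m[unfolded B_def] simp del: power_Suc intro: int_module.span_base)
  qed
qed

lemma mult_in_int_span:
  fixes c :: "'a::comm_ring_1"
  assumes "z \<in> int_module.span S" "\<And>s. s \<in> S \<Longrightarrow> c * s \<in> int_module.span T"
  shows "c * z \<in> int_module.span T"
  using assms(1)
proof (induction rule: int_module.span_induct_alt)
  case base
  show ?case using int_module.span_zero by simp
next
  case (step k s z)
  then have "of_int k * (c * s) + c * z \<in> int_module.span T"
    by (intro int_module.span_add int_module.span_scale) (auto intro: assms(2))
  then show ?case by (simp add: algebra_simps)
qed

lemma ex_common_stable_int_span:
  fixes x y :: "'a::field_char_0"
  assumes "algebraic_int x" "algebraic_int y"
  obtains B where "finite B" "1 \<in> B"
    "\<And>b. b \<in> B \<Longrightarrow> x * b \<in> int_module.span B" "\<And>b. b \<in> B \<Longrightarrow> y * b \<in> int_module.span B"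
proof -
  obtain P where P: "finite P" "1 \<in> P" "\<And>a. a \<in> P \<Longrightarrow> x * a \<in> int_module.span P"
    using ex_stable_int_span_if_algebraic_int[OF assms(1)] by blast
  obtain Q where Q: "finite Q" "1 \<in> Q" "\<And>b. b \<in> Q \<Longrightarrow> y * b \<in> int_module.span Q"
    using ex_stable_int_span_if_algebraic_int[OF assms(2)] by blast
  define B where "B = {a * b |a b. a \<in> P \<and> b \<in> Q}"
  have span: "a * b \<in> int_module.span B" if "a \<in> P" "b \<in> Q" for a b
    using that by (intro int_module.span_base) (auto simp: B_def)
  show thesis
  proof
    show "finite B" "1 \<in> B"
      using P Q unfolding B_def by (auto simp: finite_image_set2 intro!: exI[of _ 1])
    fix c assume "c \<in> B"
    then obtain a b where ab: "a \<in> P" "b \<in> Q" "c = a * b" by (auto simp: B_def)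
    have "b * (x * a) \<in> int_module.span B"
      using mult_in_int_span[OF P(3)[OF ab(1)]] span ab(2) by (metis mult.commute)
    moreover have "a * (y * b) \<in> int_module.span B"
      using mult_in_int_span[OF Q(3)[OF ab(2)]] span ab(1) by metis
    ultimately show "x * c \<in> int_module.span B" "y * c \<in> int_module.span B"
      unfolding ab(3) by (metis mult.assoc mult.commute)+
  qed
qed

lemma algebraic_int_add [intro]:
  fixes x y :: "'a::field_char_0"
  assumes "algebraic_int x" "algebraic_int y"
  shows "algebraic_int (x + y)"
proof -
  obtain B where B: "finite B" "1 \<in> B"
    "\<And>b. b \<in> B \<Longrightarrow> x * b \<in> int_module.span B" "\<And>b. b \<in> B \<Longrightarrow> y * b \<in> int_module.span B"
    using ex_common_stable_int_span[OF assms] by blast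
  have "(x + y) * b \<in> int_module.span B" if "b \<in> B" for b
    using int_module.span_add[OF B(3,4)[OF that]] by (simp only: distrib_right)
  then show ?thesis by (rule algebraic_int_if_stable_int_span[OF B(1,2) one_neq_zero])
qed

lemma algebraic_int_mult [intro]:
  fixes x y :: "'a::field_char_0"
  assumes "algebraic_int x" "algebraic_int y"
  shows "algebraic_int (x * y)"
proof -
  obtain B where B: "finite B" "1 \<in> B"
    "\<And>b. b \<in> B \<Longrightarrow> x * b \<in> int_module.span B" "\<And>b. b \<in> B \<Longrightarrow> y * b \<in> int_module.span B"
    using ex_common_stable_int_span[OF assms] by blast
  have "(x * y) * b \<in> int_module.span B" if "b \<in> B" for b
    using mult_in_int_span[OF B(4)[OF that] B(3)] by (simp only: mult.assoc)
  then show ?thesis by (rule algebraic_int_if_stable_int_span[OF B(1,2) one_neq_zero])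
qed

lemma algebraic_int_power [intro]:
  fixes x :: "'a::field_char_0"
  shows "algebraic_int x \<Longrightarrow> algebraic_int (x ^ k)"
  by (induction k) auto

lemma algebraic_int_sum [intro]:
  fixes g :: "'b \<Rightarrow> 'a::field_char_0"
  shows "(\<And>i. i \<in> A \<Longrightarrow> algebraic_int (g i)) \<Longrightarrow> algebraic_int (sum g A)"
  by (induction A rule: infinite_finite_induct) auto

lemma algebraic_int_root_of_unity:
  fixes z :: "'a::field_char_0"
  assumes "z ^ n = 1" "n > 0"
  shows "algebraic_int z"
  by (rule algebraic_int_root[where p = "monom 1 n" and y = 1])
     (use assms in \<open>auto simp: poly_monom degree_monom_eq\<close>)

section \<open>Congruences between algebraic integers\<close>

definition alg_cong :: "nat \<Rightarrow> 'a::field_char_0 \<Rightarrow> 'a \<Rightarrow> bool" where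
  "alg_cong m x y \<longleftrightarrow> (\<exists>z. algebraic_int z \<and> x - y = of_nat m * z)"

lemma alg_congI: "x - y = of_nat m * z \<Longrightarrow> algebraic_int z \<Longrightarrow> alg_cong m x y"
  by (auto simp: alg_cong_def)

lemma alg_cong_refl [simp]: "alg_cong m x x"
  by (rule alg_congI[of _ _ _ 0]) auto

lemma alg_cong_sym: "alg_cong m x y \<Longrightarrow> alg_cong m y x"
  by (metis algebraic_int_minus alg_cong_def minus_diff_eq mult_minus_right)

lemma alg_cong_add:
  assumes "alg_cong m x y" "alg_cong m x' y'"
  shows "alg_cong m (x + x') (y + y')"
proof -
  obtain z z' where "algebraic_int z" "algebraic_int z'"
    "x - y = of_nat m * z" "x' - y' = of_nat m * z'"
    using assms by (auto simp: alg_cong_def)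
  then show ?thesis by (intro alg_congI[of _ _ _ "z + z'"]) (auto simp: algebra_simps)
qed

lemma alg_cong_trans [trans]:
  assumes "alg_cong m x y" "alg_cong m y z"
  shows "alg_cong m x z"
proof -
  obtain a b where "algebraic_int a" "algebraic_int b" "x - y = of_nat m * a" "y - z = of_nat m * b"
    using assms by (auto simp: alg_cong_def)
  then show ?thesis by (intro alg_congI[of _ _ _ "a + b"]) (auto simp: algebra_simps)
qed

lemma alg_cong_mult_right:
  assumes "alg_cong m x y" "algebraic_int c"
  shows "alg_cong m (x * c) (y * c)"
proof -
  obtain z where "algebraic_int z" "x - y = of_nat m * z"
    using assms(1) by (auto simp: alg_cong_def)
  then show ?thesis
    using assms(2) by (intro alg_congI[of _ _ _ "z * c"]) (auto simp flip: left_diff_distrib)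
qed

lemma alg_cong_sum:
  "(\<And>i. i \<in> A \<Longrightarrow> alg_cong m (g i) (h i)) \<Longrightarrow> alg_cong m (sum g A) (sum h A)"
  by (induction A rule: infinite_finite_induct) (auto intro: alg_cong_add)

lemma alg_cong_of_int_iff:
  "alg_cong m (of_int k :: 'a::field_char_0) (of_int l) \<longleftrightarrow> [k = l] (mod int m)"
proof
  assume "[k = l] (mod int m)"
  then obtain c where "k - l = int m * c" by (auto simp: cong_iff_dvd_diff)
  then have "(of_int (k - l) :: 'a) = of_int (int m * c)" by (rule arg_cong)
  then show "alg_cong m (of_int k :: 'a) (of_int l)"
    by (intro alg_congI[of _ _ _ "of_int c"]) auto
next
  assume "alg_cong m (of_int k :: 'a) (of_int l)"
  then obtain z :: 'a where z: "algebraic_int z" "of_int (k - l) = of_nat m * z"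
    by (auto simp: alg_cong_def)
  show "[k = l] (mod int m)"
  proof (cases "m = 0")
    case False
    then have "z = of_int (k - l) / of_nat m" using z(2) by (simp add: field_simps)
    then have "z \<in> \<rat>" by simp
    then obtain c where "z = of_int c"
      using rational_algebraic_int_is_int[OF z(1)] Ints_cases by blast
    then have "(of_int (k - l) :: 'a) = of_int (int m * c)" using z(2) by simp
    then have "k - l = int m * c" unfolding of_int_eq_iff .
    then show ?thesis by (simp add: cong_iff_dvd_diff)
  qed (use z(2) in simp)
qed

lemma alg_cong_power_prime_add:
  fixes x y :: "'a::field_char_0"
  assumes "prime p" "algebraic_int x" "algebraic_int y"
  shows "alg_cong p ((x + y) ^ p) (x ^ p + y ^ p)"
proof -
  have p: "p > 0" using assms(1) prime_gt_0_nat by blast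
  have "{..p} = insert 0 (insert p {0<..<p})" using p by auto
  then have "(x + y) ^ p = (\<Sum>k\<in>{0<..<p}. of_nat (p choose k) * x ^ k * y ^ (p - k)) + (x ^ p + y ^ p)"
    unfolding binomial_ring using p by simp
  also have "alg_cong p \<dots> ((\<Sum>k\<in>{0<..<p}. 0) + (x ^ p + y ^ p))"
  proof (intro alg_cong_add alg_cong_sum alg_cong_refl)
    fix k assume "k \<in> {0<..<p}"
    then obtain c where "p choose k = p * c"
      using dvd_choose_prime[of k p] assms(1) by auto
    then show "alg_cong p (of_nat (p choose k) * x ^ k * y ^ (p - k)) 0"
      using assms(2,3) by (intro alg_congI[of _ _ _ "of_nat c * x ^ k * y ^ (p - k)"]) auto
  qed
  finally show ?thesis by simp
qed

lemma alg_cong_power_prime_sum: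
  fixes g :: "'b \<Rightarrow> 'a::field_char_0"
  assumes "prime p" "\<And>i. i \<in> A \<Longrightarrow> algebraic_int (g i)"
  shows "alg_cong p ((\<Sum>i\<in>A. g i) ^ p) (\<Sum>i\<in>A. g i ^ p)"
  using assms(2)
proof (induction A rule: infinite_finite_induct)
  case (insert a A)
  then have "alg_cong p ((g a + sum g A) ^ p) (g a ^ p + sum g A ^ p)"
    by (intro alg_cong_power_prime_add assms(1)) auto
  also have "alg_cong p \<dots> (g a ^ p + (\<Sum>i\<in>A. g i ^ p))"
    using insert by (intro alg_cong_add) auto
  finally show ?case using insert.hyps by simp
qed (use assms(1) prime_gt_0_nat in \<open>auto simp: power_0_left\<close>)

lemma alg_cong_of_int_power_prime:
  assumes "prime p"
  shows "alg_cong p (of_int k ^ p) (of_int k :: 'a::field_char_0)"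
proof -
  \<comment> \<open>Fermat's little theorem is the additivity of the Frobenius map, applied to a sum of ones.\<close>
  define n where "n = nat (k mod int p)"
  have n: "[k = int n] (mod int p)"
    using assms prime_gt_0_nat[of p] by (simp add: n_def cong_def)
  then have "alg_cong p (of_int (k ^ p) :: 'a) (of_int (int n ^ p))"
    by (intro alg_cong_of_int_iff[THEN iffD2] cong_pow)
  also have "alg_cong p (of_int (int n ^ p) :: 'a) (of_int (int n))"
    using alg_cong_power_prime_sum[OF assms, of "{..<n}" "\<lambda>_. 1 :: 'a"] by simp
  also have "alg_cong p (of_int (int n) :: 'a) (of_int k)"
    using n by (simp only: alg_cong_of_int_iff cong_sym)
  finally show ?thesis by simp
qed

section \<open>Ramanujan sums\<close>

lemma sum_powers_root_of_unity:
  fixes z :: "'a::field"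
  assumes "z ^ m = 1"
  shows "(\<Sum>k<m. z ^ k) = (if z = 1 then of_nat m else 0)"
  using geometric_sum[of z m] assms by auto

lemma sum_by_gcd:
  fixes m :: nat
  assumes "m > 0"
  shows "(\<Sum>k\<in>{0<..m}. F k) = (\<Sum>d | d dvd m. \<Sum>k\<in>totatives (m div d). F (d * k))"
proof -
  have "(\<Sum>k\<in>{0<..m}. F k) = (\<Sum>d | d dvd m. \<Sum>k\<in>{k\<in>{0<..m}. gcd k m = d}. F k)"
    using assms by (intro sum.group[symmetric]) auto
  also have "\<dots> = (\<Sum>d | d dvd m. \<Sum>k\<in>totatives (m div d). F (d * k))"
  proof (rule sum.cong[OF refl])
    fix d assume "d \<in> {d. d dvd m}"
    then show "(\<Sum>k\<in>{k\<in>{0<..m}. gcd k m = d}. F k) = (\<Sum>k\<in>totatives (m div d). F (d * k))"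
      using sum.reindex_bij_betw[OF bij_betw_totatives_gcd_eq[of d m], of F] assms
      by (simp add: mult.commute[of _ d])
  qed
  finally show ?thesis .
qed

lemma ramanujan_sum_Ints:
  fixes z :: "'a::field"
  assumes "m > 0" "z ^ m = 1"
  shows "(\<Sum>k\<in>totatives m. z ^ k) \<in> \<int>"
  using assms
proof (induction m arbitrary: z rule: less_induct)
  case (less m)
  define D where "D = {d. d dvd m} - {1}"
  have "finite D" "1 \<notin> D" "{d. d dvd m} = insert 1 D"
    using less.prems(1) by (auto simp: D_def)
  then have "(\<Sum>k\<in>{0<..m}. z ^ k) =
      (\<Sum>k\<in>totatives m. z ^ k) + (\<Sum>d\<in>D. \<Sum>k\<in>totatives (m div d). (z ^ d) ^ k)"
    by (simp add: sum_by_gcd[OF less.prems(1)] power_mult)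
  moreover have "(\<Sum>k\<in>{0<..m}. z ^ k) \<in> \<int>"
  proof -
    have "(\<Sum>k\<in>{0<..m}. z ^ k) = (\<Sum>k<m. z ^ Suc k)"
      by (rule sum.reindex_bij_witness[of _ Suc "\<lambda>k. k - 1"]) auto
    also have "\<dots> = z * (\<Sum>k<m. z ^ k)" by (simp add: sum_distrib_left)
    also have "\<dots> \<in> \<int>" using sum_powers_root_of_unity[OF less.prems(2)] by auto
    finally show ?thesis .
  qed
  moreover have "(\<Sum>d\<in>D. \<Sum>k\<in>totatives (m div d). (z ^ d) ^ k) \<in> \<int>"
  proof (rule Ints_sum, rule less.IH)
    fix d assume "d \<in> D"
    then have "d dvd m" "d \<noteq> 1" by (auto simp: D_def)
    moreover from this have "d \<noteq> 0" using less.prems(1) by auto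
    ultimately have d: "d dvd m" "d > 1" by auto
    then show "m div d < m" "0 < m div d"
      using less.prems(1) by auto
    show "(z ^ d) ^ (m div d) = 1"
      using d(1) less.prems(2) by (simp flip: power_mult)
  qed
  ultimately show ?case by (metis Ints_diff add_diff_cancel_right')
qed

section \<open>Eisenstein integers and their Galois conjugates\<close>

definition omega :: complex where
  "omega = Complex (- 1 / 2) (sqrt 3 / 2)"

lemma cnj_omega: "cnj omega = omega ^ 2"
  by (simp add: omega_def complex_eq_iff power2_eq_square)

lemma omega_cube: "omega ^ 3 = 1"
  by (simp add: omega_def complex_eq_iff power3_eq_cube)

text \<open>
  The action on \<open>\<rat>(\<omega>)\<close> of the automorphism \<open>\<zeta> \<mapsto> \<zeta>\<^sup>k\<close> of a cyclotomic field containing it; meaningful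
  only for \<open>k\<close> prime to 3.
\<close>

definition galois3 :: "nat \<Rightarrow> complex \<Rightarrow> complex" where
  "galois3 k z = (if [k = 1] (mod 3) then z else cnj z)"

lemma galois3_1 [simp]: "galois3 (Suc 0) z = z"
  by (simp add: galois3_def)

lemma galois3_cong: "[j = k] (mod 3) \<Longrightarrow> galois3 j z = galois3 k z"
  by (auto simp: galois3_def cong_def)

lemma galois3_real: "z \<in> \<real> \<Longrightarrow> galois3 k z = z"
  by (auto simp: galois3_def elim: Reals_cases)

lemma norm_galois3 [simp]: "norm (galois3 k z) = norm z"
  by (simp add: galois3_def)

lemma not_3_dvd_cases:
  assumes "\<not> 3 dvd (k::nat)"
  obtains "[k = 1] (mod 3)" | "[k = 2] (mod 3)"
proof -
  have "k mod 3 = 1 \<or> k mod 3 = 2" using assms by presburger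
  then show thesis using that by (auto simp: cong_def)
qed

lemma coprime_3_iff: "coprime k 3 \<longleftrightarrow> \<not> 3 dvd k" for k :: nat
  using prime_imp_coprime[of 3 k] coprime_common_divisor[of k 3 3] by (auto simp: coprime_commute)

lemma galois3_mult_exponent:
  assumes "\<not> 3 dvd j" "\<not> 3 dvd k"
  shows "galois3 (j * k) z = galois3 j (galois3 k z)"
proof -
  have "[j * k = (j mod 3) * (k mod 3)] (mod 3)" by (simp add: cong_def mod_mult_eq)
  moreover have "j mod 3 = 1 \<or> j mod 3 = 2" "k mod 3 = 1 \<or> k mod 3 = 2"
    using assms by presburger+
  ultimately show ?thesis by (auto simp: galois3_def cong_def)
qed

lemma galois3_omega:
  assumes "\<not> 3 dvd k"
  shows "galois3 k omega = omega ^ k"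
proof -
  have "omega ^ k = omega ^ (3 * (k div 3) + k mod 3)" by simp
  also have "\<dots> = omega ^ (k mod 3)" unfolding power_add power_mult omega_cube by simp
  also have "\<dots> = galois3 k omega"
    using assms by (cases rule: not_3_dvd_cases) (simp_all add: cong_def galois3_def cnj_omega)
  finally show ?thesis by simp
qed

definition eisenstein_ints :: "complex set" where
  "eisenstein_ints = {of_int a + of_int b * omega |a b. True}"

lemma eisenstein_intsI: "of_int a + of_int b * omega \<in> eisenstein_ints"
  unfolding eisenstein_ints_def by blast

lemma eisenstein_intsE:
  assumes "v \<in> eisenstein_ints"
  obtains a b where "v = of_int a + of_int b * omega"
    "\<And>k. \<not> 3 dvd k \<Longrightarrow> galois3 k v = of_int a + of_int b * omega ^ k"
proof -
  obtain a b where v: "v = of_int a + of_int b * omega"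
    using assms by (auto simp: eisenstein_ints_def)
  have "galois3 k v = of_int a + of_int b * galois3 k omega" for k
    by (simp add: v galois3_def)
  then show thesis using v that galois3_omega by metis
qed

lemma algebraic_int_eisenstein:
  assumes "v \<in> eisenstein_ints"
  shows "algebraic_int v"
proof -
  have "algebraic_int omega" using algebraic_int_root_of_unity[OF omega_cube] by simp
  then show ?thesis using assms by (auto simp: eisenstein_ints_def)
qed

lemma cnj_eisenstein:
  assumes "v \<in> eisenstein_ints"
  shows "cnj v \<in> eisenstein_ints"
proof -
  obtain a b where "v = of_int a + of_int b * omega"
    using assms by (auto simp: eisenstein_ints_def)
  then have "cnj v = of_int (a - b) + of_int (- b) * omega"
    by (simp add: omega_def complex_eq_iff)
  then show ?thesis by (simp only: eisenstein_intsI)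
qed

lemma galois3_eisenstein: "v \<in> eisenstein_ints \<Longrightarrow> galois3 k v \<in> eisenstein_ints"
  by (simp add: galois3_def cnj_eisenstein)

lemma eisenstein_diff:
  assumes "v \<in> eisenstein_ints" "w \<in> eisenstein_ints"
  shows "v - w \<in> eisenstein_ints"
proof -
  obtain a b c d where "v = of_int a + of_int b * omega" "w = of_int c + of_int d * omega"
    using assms by (auto simp: eisenstein_ints_def)
  then have "v - w = of_int (a - c) + of_int (b - d) * omega" by (simp add: algebra_simps)
  then show ?thesis by (simp only: eisenstein_intsI)
qed

lemma eisenstein_norm_sq_Ints:
  assumes "v \<in> eisenstein_ints"
  shows "(norm v)\<^sup>2 \<in> \<int>"
proof -
  obtain a b where "v = of_int a + of_int b * omega"
    using assms by (auto simp: eisenstein_ints_def)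
  then have "(norm v)\<^sup>2 = (of_int a - of_int b / 2)\<^sup>2 + (of_int b * sqrt 3 / 2)\<^sup>2"
    by (simp add: cmod_power2 omega_def)
  also have "\<dots> = of_int (a\<^sup>2 - a * b + b\<^sup>2)"
    by (simp add: power_mult_distrib power_divide power2_diff)
  finally show ?thesis by simp
qed

lemma eisenstein_eq_0_if_alg_cong_0:
  assumes v: "v \<in> eisenstein_ints" and cong: "alg_cong p (of_nat n * v) 0"
    and bound: "of_nat n * (norm v)\<^sup>2 < of_nat p" and "n > 0"
  shows "v = 0"
proof (rule ccontr)
  assume "v \<noteq> 0"
  obtain c where c: "(norm v)\<^sup>2 = of_int c"
    using eisenstein_norm_sq_Ints[OF v] Ints_cases by blast
  have "alg_cong p (of_nat n * v * cnj v) (0 * cnj v)"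
    using cong v by (intro alg_cong_mult_right) (auto intro: algebraic_int_eisenstein)
  also have "of_nat n * v * cnj v = of_int (int n * c)"
    using c by (simp add: mult.assoc complex_norm_square[symmetric] flip: of_real_power)
  finally have "int p dvd int n * c"
    using alg_cong_of_int_iff[of p "int n * c" 0, where 'a = complex] by (simp add: cong_0_iff)
  moreover have "real_of_int (int n * c) > 0"
    using c[symmetric] \<open>v \<noteq> 0\<close> \<open>n > 0\<close> by simp
  then have "int n * c > 0" unfolding of_int_0_less_iff .
  ultimately have "int p \<le> int n * c" by (rule zdvd_imp_le)
  then have "real_of_int (int p) \<le> real_of_int (int n * c)" unfolding of_int_le_iff .
  then show False using bound c by simp
qed

lemma alg_cong_eisenstein_power_prime:
  assumes "v \<in> eisenstein_ints" "prime p" "\<not> 3 dvd p"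
  shows "alg_cong p (v ^ p) (galois3 p v)"
proof -
  obtain a b where v: "v = of_int a + of_int b * omega"
    "galois3 p v = of_int a + of_int b * omega ^ p"
    using eisenstein_intsE[OF assms(1)] assms(3) by metis
  have omega: "algebraic_int omega" using algebraic_int_root_of_unity[OF omega_cube] by simp
  then have "alg_cong p (v ^ p) (of_int a ^ p + (of_int b * omega) ^ p)"
    unfolding v(1) by (intro alg_cong_power_prime_add assms(2)) auto
  also have "of_int a ^ p + (of_int b * omega) ^ p = of_int a ^ p + of_int b ^ p * omega ^ p"
    by (simp add: power_mult_distrib)
  also have "alg_cong p \<dots> (of_int a + of_int b * omega ^ p)"
    using omega by (intro alg_cong_add alg_cong_mult_right alg_cong_of_int_power_prime assms(2)) auto
  finally show ?thesis by (simp add: v(2))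
qed

lemma galois3_trace_Ints:
  assumes "v \<in> eisenstein_ints" "z ^ n = 1" "n > 0"
  shows "(\<Sum>k\<in>totatives (3 * n). galois3 k v * z ^ k) \<in> \<int>"
proof -
  obtain a b where v: "\<And>k. \<not> 3 dvd k \<Longrightarrow> galois3 k v = of_int a + of_int b * omega ^ k"
    using eisenstein_intsE[OF assms(1)] by metis
  have "galois3 k v * z ^ k = of_int a * z ^ k + of_int b * (omega * z) ^ k"
    if "k \<in> totatives (3 * n)" for k
    using that v by (simp add: in_totatives_iff coprime_3_iff algebra_simps)
  then have "(\<Sum>k\<in>totatives (3 * n). galois3 k v * z ^ k) =
      of_int a * (\<Sum>k\<in>totatives (3 * n). z ^ k) + of_int b * (\<Sum>k\<in>totatives (3 * n). (omega * z) ^ k)"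
    by (simp add: sum.distrib sum_distrib_left)
  moreover have "z ^ (3 * n) = 1" "(omega * z) ^ (3 * n) = 1"
    using assms(2) by (simp_all add: power_mult_distrib power_mult[of omega] omega_cube)
       (simp_all add: power_mult mult.commute[of 3])
  then have "(\<Sum>k\<in>totatives (3 * n). z ^ k) \<in> \<int>" "(\<Sum>k\<in>totatives (3 * n). (omega * z) ^ k) \<in> \<int>"
    using assms(3) by (simp_all add: ramanujan_sum_Ints)
  ultimately show ?thesis by simp
qed

section \<open>Powers in finite groups\<close>

context group
begin

lemma pow_cong_ord:
  assumes "x \<in> carrier G" "[j = k] (mod ord x)"
  shows "x [^] j = x [^] (k::nat)"
proof -
  have "int (ord x) dvd int k - int j"
    using assms(2) by (metis cong_iff_dvd_diff cong_int_iff cong_sym)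
  then have "x [^] int j = x [^] int k"
    using int_pow_eq[OF assms(1)] by simp
  then show ?thesis by (simp add: int_pow_int)
qed

lemma ex_pow_inverse:
  assumes "coprime (k::nat) n"
  shows "\<exists>l::nat. \<forall>x\<in>carrier G. ord x dvd n \<longrightarrow> (x [^] k) [^] l = x"
proof -
  obtain l where l: "[k * l = 1] (mod n)"
    using cong_solve_coprime_nat[OF assms] by auto
  show ?thesis
  proof (intro exI ballI impI)
    fix x assume x: "x \<in> carrier G" "ord x dvd n"
    then have "x [^] (k * l) = x [^] (1::nat)"
      using l by (intro pow_cong_ord) (auto dest: cong_dvd_modulus_nat)
    then show "(x [^] k) [^] l = x" using x by (simp add: nat_pow_pow)
  qed
qed

lemma pow_neg_exponent:
  assumes "x \<in> carrier G" "ord x dvd n" "n > 0"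
  shows "x [^] (k * (n - 1)) = inv (x [^] (k::nat))"
proof -
  have "k * (n - 1) + k = k * n" using assms(3) by (simp add: algebra_simps)
  then have "x [^] (k * (n - 1)) \<otimes> x [^] k = x [^] (k * n)"
    using assms(1) by (simp add: nat_pow_mult)
  also have "\<dots> = \<one>" using assms(1,2) by (simp add: pow_eq_id)
  finally show ?thesis using assms(1) by (simp add: inv_equality)
qed

lemma ord_pow_eq_ord_iff:
  assumes "x \<in> carrier G" "ord x > 0"
  shows "ord (x [^] (k::nat)) = ord x \<longleftrightarrow> coprime k (ord x)"
proof -
  have "ord (x [^] k) = ord x \<longleftrightarrow> gcd (ord x) k = 1"
    using assms(2) by (auto simp: ord_pow_gen[OF assms(1)] div_eq_dividend_iff)
  then show ?thesis by (metis coprime_commute coprime_iff_gcd_eq_1)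
qed

lemma sum_translate:
  "g \<in> carrier G \<Longrightarrow> (\<Sum>z\<in>carrier G. F (g \<otimes> z)) = (\<Sum>z\<in>carrier G. F z)"
  by (rule sum.reindex_bij_witness[of _ "\<lambda>z. inv g \<otimes> z" "\<lambda>z. g \<otimes> z"])
     (auto simp: m_assoc[symmetric])

end

locale finite_group = group +
  assumes finite_carrier: "finite (carrier G)"
begin

lemma order_pos: "order G > 0"
  using finite_carrier by (simp add: order_gt_0_iff_finite)

lemma ord_pos: "x \<in> carrier G \<Longrightarrow> ord x > 0"
  using ord_ge_1[OF finite_carrier] by fastforce

lemma bij_betw_pow:
  assumes "coprime k (order G)"
  shows "bij_betw (\<lambda>x. x [^] (k::nat)) (carrier G) (carrier G)"
proof -
  obtain l :: nat where "\<And>x. x \<in> carrier G \<Longrightarrow> (x [^] k) [^] l = x"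
    using ex_pow_inverse[OF assms] ord_dvd_group_order by blast
  then have "inj_on (\<lambda>x. x [^] k) (carrier G)" by (rule inj_on_inverseI)
  moreover from this have "(\<lambda>x. x [^] k) ` carrier G = carrier G"
    by (intro endo_inj_surj finite_carrier) auto
  ultimately show ?thesis by (simp add: bij_betw_def)
qed

lemma pow_mem_iff:
  assumes "coprime k (order G)"
    and "A \<subseteq> carrier G" "\<And>y. y \<in> A \<Longrightarrow> y [^] k \<in> A" "x \<in> carrier G"
  shows "x [^] (k::nat) \<in> A \<longleftrightarrow> x \<in> A"
proof -
  have inj: "inj_on (\<lambda>x. x [^] k) (carrier G)"
    using bij_betw_pow[OF assms(1)] by (rule bij_betw_imp_inj_on)
  have "(\<lambda>x. x [^] k) ` A = A"
    using assms(2,3) finite_carrier inj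
    by (intro endo_inj_surj) (auto intro: finite_subset inj_on_subset)
  then show ?thesis
    using inj_on_image_mem_iff[OF inj assms(4,2)] by simp
qed

lemma sum_pow:
  assumes "coprime k (order G)"
  shows "(\<Sum>z\<in>carrier G. F (z [^] (k::nat))) = (\<Sum>z\<in>carrier G. F z)"
  by (rule sum.reindex_bij_betw[OF bij_betw_pow[OF assms]])

end

section \<open>Characters of finite abelian groups\<close>

definition characters :: "('a, 'b) monoid_scheme \<Rightarrow> ('a \<Rightarrow> complex) set" where
  "characters G = {\<chi> \<in> extensional (carrier G). \<chi> \<one>\<^bsub>G\<^esub> = 1 \<and>
     (\<forall>x\<in>carrier G. \<forall>y\<in>carrier G. \<chi> (x \<otimes>\<^bsub>G\<^esub> y) = \<chi> x * \<chi> y)}"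

definition dft :: "('a, 'b) monoid_scheme \<Rightarrow> ('a \<Rightarrow> complex) \<Rightarrow> ('a \<Rightarrow> complex) \<Rightarrow> complex" where
  "dft G f \<chi> = (\<Sum>x\<in>carrier G. f x * \<chi> x)"

definition translation_invariant_subspace ::
    "('a, 'b) monoid_scheme \<Rightarrow> ('a \<Rightarrow> complex) set \<Rightarrow> bool" where
  "translation_invariant_subspace G V \<longleftrightarrow>
     (\<forall>\<phi>\<in>V. \<forall>\<psi>\<in>V. (\<lambda>x. \<phi> x + \<psi> x) \<in> V) \<and>
     (\<forall>\<phi>\<in>V. \<forall>c. (\<lambda>x. c * \<phi> x) \<in> V) \<and>
     (\<forall>\<phi>\<in>V. \<forall>g\<in>carrier G. (\<lambda>x. \<phi> (g \<otimes>\<^bsub>G\<^esub> x)) \<in> V)"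

lemma
  assumes "translation_invariant_subspace G V"
  shows translation_invariant_subspace_add: "\<phi> \<in> V \<Longrightarrow> \<psi> \<in> V \<Longrightarrow> (\<lambda>x. \<phi> x + \<psi> x) \<in> V"
    and translation_invariant_subspace_scale: "\<phi> \<in> V \<Longrightarrow> (\<lambda>x. c * \<phi> x) \<in> V"
    and translation_invariant_subspace_translate:
      "\<phi> \<in> V \<Longrightarrow> g \<in> carrier G \<Longrightarrow> (\<lambda>x. \<phi> (g \<otimes>\<^bsub>G\<^esub> x)) \<in> V"
  using assms by (auto simp: translation_invariant_subspace_def)

lemma translation_invariant_subspace_sum:
  assumes V: "translation_invariant_subspace G V" and "V \<noteq> {}"
    and "\<And>i. i \<in> A \<Longrightarrow> F i \<in> V"
  shows "(\<lambda>x. \<Sum>i\<in>A. F i x) \<in> V"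
proof -
  obtain \<phi> where "\<phi> \<in> V" using assms(2) by blast
  then have zero: "(\<lambda>x. 0) \<in> V"
    using translation_invariant_subspace_scale[OF V, of \<phi> 0] by simp
  show ?thesis
    using assms(3)
  proof (induction A rule: infinite_finite_induct)
    case (insert i A)
    then show ?case
      using translation_invariant_subspace_add[OF V, of "F i" "\<lambda>x. \<Sum>i\<in>A. F i x"] by simp
  qed (simp_all add: zero)
qed

locale finite_comm_group = finite_group + comm_group
begin

lemma char_one: "\<chi> \<in> characters G \<Longrightarrow> \<chi> \<one> = 1"
  by (simp add: characters_def)

lemma char_mult:
  "\<chi> \<in> characters G \<Longrightarrow> x \<in> carrier G \<Longrightarrow> y \<in> carrier G \<Longrightarrow> \<chi> (x \<otimes> y) = \<chi> x * \<chi> y"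
  by (simp add: characters_def)

lemma char_pow:
  "\<chi> \<in> characters G \<Longrightarrow> x \<in> carrier G \<Longrightarrow> \<chi> (x [^] (k::nat)) = \<chi> x ^ k"
  by (induction k) (auto simp: char_one char_mult)

lemma char_inv:
  "\<chi> \<in> characters G \<Longrightarrow> x \<in> carrier G \<Longrightarrow> \<chi> x * \<chi> (inv x) = 1"
  by (metis char_mult char_one inv_closed r_inv)

lemma char_pow_order: "\<chi> \<in> characters G \<Longrightarrow> x \<in> carrier G \<Longrightarrow> \<chi> x ^ order G = 1"
  by (metis char_one char_pow pow_order_eq_1)

lemma algebraic_int_char: "\<chi> \<in> characters G \<Longrightarrow> x \<in> carrier G \<Longrightarrow> algebraic_int (\<chi> x)"
  using algebraic_int_root_of_unity[OF char_pow_order order_pos] .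

lemma finite_characters: "finite (characters G)"
proof (rule finite_subset)
  show "characters G \<subseteq> (carrier G \<rightarrow>\<^sub>E {z. z ^ order G = 1})"
    using char_pow_order by (auto simp: PiE_def characters_def)
  show "finite (carrier G \<rightarrow>\<^sub>E {z::complex. z ^ order G = 1})"
    using finite_carrier order_pos by (intro finite_PiE finite_roots_unity) auto
qed

definition isotypic_part :: "'a \<Rightarrow> complex \<Rightarrow> ('a \<Rightarrow> complex) \<Rightarrow> 'a \<Rightarrow> complex" where
  "isotypic_part g c \<phi> z = (\<Sum>i<order G. c ^ i * \<phi> (g [^] i \<otimes> z))"

lemma isotypic_part_translate:
  assumes "g \<in> carrier G" "z \<in> carrier G" "c ^ order G = 1"
  shows "c * isotypic_part g c \<phi> (g \<otimes> z) = isotypic_part g c \<phi> z"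
proof -
  let ?f = "\<lambda>i. c ^ i * \<phi> (g [^] i \<otimes> z)"
  have "c * isotypic_part g c \<phi> (g \<otimes> z) = (\<Sum>i<order G. ?f (Suc i))"
    unfolding isotypic_part_def sum_distrib_left using assms(1,2) by (simp add: m_assoc mult.assoc)
  also have "\<dots> = (\<Sum>i<Suc (order G). ?f i) - ?f 0"
    by (subst sum.lessThan_Suc_shift) simp
  also have "\<dots> = isotypic_part g c \<phi> z"
    using assms by (simp add: isotypic_part_def pow_order_eq_1)
  finally show ?thesis .
qed

text \<open>
  As a function of \<open>c\<close>, the isotypic part at \<open>z\<close> is a polynomial of degree less than the number of
  admissible values of \<open>c\<close>.
\<close>

lemma ex_isotypic_part_neq_0:
  assumes "z \<in> carrier G" "\<phi> z \<noteq> 0"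
  shows "\<exists>c. c ^ order G = 1 \<and> isotypic_part g c \<phi> z \<noteq> 0"
proof (rule ccontr)
  assume "\<nexists>c. c ^ order G = 1 \<and> isotypic_part g c \<phi> z \<noteq> 0"
  then have vanish: "isotypic_part g c \<phi> z = 0" if "c ^ order G = 1" for c
    using that by blast
  define P where "P = (\<Sum>i<order G. monom (\<phi> (g [^] i \<otimes> z)) i)"
  have "coeff P 0 = \<phi> z"
    using order_pos assms(1) by (simp add: P_def coeff_sum if_distrib cong: if_cong)
  then have "P \<noteq> 0" using assms(2) by auto
  have "poly P c = isotypic_part g c \<phi> z" for c
    by (simp add: P_def isotypic_part_def poly_sum poly_monom mult.commute)
  then have "{c. c ^ order G = 1} \<subseteq> {c. poly P c = 0}" using vanish by auto
  then have "card {c::complex. c ^ order G = 1} \<le> card {c. poly P c = 0}"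
    by (rule card_mono[OF poly_roots_finite[OF \<open>P \<noteq> 0\<close>]])
  also have "\<dots> \<le> degree P" by (rule card_poly_roots_bound[OF \<open>P \<noteq> 0\<close>])
  also have "\<dots> < order G"
    unfolding P_def using order_pos by (intro degree_sum_less le_less_trans[OF degree_monom_le]) auto
  finally show False using card_roots_unity_eq[OF order_pos] by simp
qed

lemma isotypic_part_eigenvector:
  assumes "g \<in> carrier G" "h \<in> carrier G" "z \<in> carrier G"
    and "\<And>z. z \<in> carrier G \<Longrightarrow> \<phi> (h \<otimes> z) = d * \<phi> z"
  shows "isotypic_part g c \<phi> (h \<otimes> z) = d * isotypic_part g c \<phi> z"
proof -
  have "\<phi> (g [^] i \<otimes> (h \<otimes> z)) = d * \<phi> (g [^] i \<otimes> z)" for i :: nat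
    using assms(4)[of "g [^] i \<otimes> z"] m_lcomm[of "g [^] i" h z] assms(1-3) by simp
  then show ?thesis
    unfolding isotypic_part_def sum_distrib_left by (intro sum.cong refl) simp
qed

lemma isotypic_part_in_invariant_subspace:
  assumes V: "translation_invariant_subspace G V" and "\<phi> \<in> V" "g \<in> carrier G"
  shows "isotypic_part g c \<phi> \<in> V"
proof -
  have "(\<lambda>z. c ^ i * \<phi> (g [^] i \<otimes> z)) \<in> V" for i
    using assms(2,3)
    by (intro translation_invariant_subspace_scale[OF V, where \<phi> = "\<lambda>z. \<phi> (g [^] i \<otimes> z)"]
        translation_invariant_subspace_translate[OF V]) auto
  then have "(\<lambda>z. \<Sum>i<order G. c ^ i * \<phi> (g [^] i \<otimes> z)) \<in> V"
    using assms(2) by (intro translation_invariant_subspace_sum[OF V]) auto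
  then show ?thesis by (simp add: isotypic_part_def[abs_def])
qed

lemma ex_common_translation_eigenvector:
  assumes V: "translation_invariant_subspace G V"
    and \<phi>: "\<phi> \<in> V" "\<exists>z\<in>carrier G. \<phi> z \<noteq> 0"
    and "finite A" "A \<subseteq> carrier G"
  shows "\<exists>\<psi>\<in>V. (\<exists>z\<in>carrier G. \<psi> z \<noteq> 0) \<and>
           (\<forall>g\<in>A. \<exists>c. \<forall>z\<in>carrier G. \<psi> (g \<otimes> z) = c * \<psi> z)"
  using assms(4,5)
proof (induction A)
  case empty
  then show ?case using \<phi> by blast
next
  case (insert g A)
  then obtain \<psi> z where \<psi>: "\<psi> \<in> V" "z \<in> carrier G" "\<psi> z \<noteq> 0"
    "\<forall>h\<in>A. \<exists>c. \<forall>z\<in>carrier G. \<psi> (h \<otimes> z) = c * \<psi> z"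
    by auto
  have g: "g \<in> carrier G" and A: "A \<subseteq> carrier G" using insert.prems by auto
  obtain c where c: "c ^ order G = 1" "isotypic_part g c \<psi> z \<noteq> 0"
    using ex_isotypic_part_neq_0[of z \<psi> g] \<psi>(2,3) by blast
  have "\<exists>d. \<forall>z\<in>carrier G. isotypic_part g c \<psi> (h \<otimes> z) = d * isotypic_part g c \<psi> z"
    if h: "h \<in> insert g A" for h
  proof (cases "h = g")
    case True
    have "c \<noteq> 0" using c(1) order_pos by (auto simp: power_0_left)
    then have "isotypic_part g c \<psi> (g \<otimes> z) = inverse c * isotypic_part g c \<psi> z"
      if "z \<in> carrier G" for z
      using isotypic_part_translate[OF g that c(1), of \<psi>] by (simp add: field_simps)
    then show ?thesis using True by blast
  next
    case False
    then obtain d where d: "\<And>z. z \<in> carrier G \<Longrightarrow> \<psi> (h \<otimes> z) = d * \<psi> z"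
      using h \<psi>(4) by blast
    have "h \<in> carrier G" using False h A by blast
    then show ?thesis using isotypic_part_eigenvector[of g h _ \<psi> d c] g d by blast
  qed
  then show ?case
    using isotypic_part_in_invariant_subspace[OF V \<psi>(1) g] \<psi>(2) c(2) by blast
qed

theorem ex_char_in_invariant_subspace:
  assumes V: "translation_invariant_subspace G V" and "\<phi> \<in> V" "\<exists>z\<in>carrier G. \<phi> z \<noteq> 0"
  shows "\<exists>\<chi>\<in>characters G. \<exists>\<psi>\<in>V. \<forall>x\<in>carrier G. \<psi> x = \<chi> x"
proof -
  obtain \<psi> where \<psi>: "\<psi> \<in> V" "\<exists>z\<in>carrier G. \<psi> z \<noteq> 0"
    "\<And>g. g \<in> carrier G \<Longrightarrow> \<exists>c. \<forall>z\<in>carrier G. \<psi> (g \<otimes> z) = c * \<psi> z"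
    using ex_common_translation_eigenvector[OF assms finite_carrier subset_refl] by blast
  have mult: "\<psi> (x \<otimes> y) * \<psi> \<one> = \<psi> x * \<psi> y" if xy: "x \<in> carrier G" "y \<in> carrier G" for x y
  proof -
    obtain c where "\<And>z. z \<in> carrier G \<Longrightarrow> \<psi> (x \<otimes> z) = c * \<psi> z" using \<psi>(3) xy(1) by blast
    from this[of y] this[of \<one>] show ?thesis using xy by simp
  qed
  obtain z where "z \<in> carrier G" "\<psi> z \<noteq> 0" using \<psi>(2) by blast
  moreover from this obtain c where "\<psi> (z \<otimes> \<one>) = c * \<psi> \<one>" using \<psi>(3)[of z] by blast
  ultimately have "\<psi> \<one> \<noteq> 0" by auto
  define \<chi> where "\<chi> = (\<lambda>x\<in>carrier G. inverse (\<psi> \<one>) * \<psi> x)"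
  show ?thesis
  proof (intro bexI ballI)
    show "\<chi> \<in> characters G"
      using mult \<open>\<psi> \<one> \<noteq> 0\<close> by (simp add: \<chi>_def characters_def field_simps)
    show "(\<lambda>x. inverse (\<psi> \<one>) * \<psi> x) \<in> V"
      by (rule translation_invariant_subspace_scale[OF V \<psi>(1)])
  qed (simp add: \<chi>_def)
qed

lemma char_orthogonality:
  assumes \<chi>: "\<chi> \<in> characters G" and \<eta>: "\<eta> \<in> characters G"
  shows "(\<Sum>x\<in>carrier G. \<chi> x * \<eta> (inv x)) = (if \<chi> = \<eta> then of_nat (order G) else 0)"
proof (cases "\<chi> = \<eta>")
  case True
  then show ?thesis using char_inv[OF \<eta>] by (simp add: Coset.order_def)
next
  case False
  then obtain g where g: "g \<in> carrier G" "\<chi> g \<noteq> \<eta> g"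
    using extensionalityI[of \<chi> "carrier G" \<eta>] \<chi> \<eta> by (auto simp: characters_def)
  define s where "s = (\<Sum>x\<in>carrier G. \<chi> x * \<eta> (inv x))"
  have "s = (\<Sum>x\<in>carrier G. \<chi> (g \<otimes> x) * \<eta> (inv (g \<otimes> x)))"
    unfolding s_def by (rule sum_translate[OF g(1), symmetric])
  also have "\<dots> = \<chi> g * \<eta> (inv g) * s"
    unfolding s_def sum_distrib_left using g(1)
    by (intro sum.cong refl) (simp add: char_mult[OF \<chi>] char_mult[OF \<eta>] inv_mult)
  finally have "\<eta> g * s = (\<eta> g * \<eta> (inv g)) * (\<chi> g * s)"
    by (metis mult.assoc mult.left_commute)
  then have "s = 0" using g(2) char_inv[OF \<eta> g(1)] by simp
  then show ?thesis using False by (simp add: s_def)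
qed

lemma translation_invariant_dft_kernel:
  "translation_invariant_subspace G {f. \<forall>\<chi>\<in>characters G. dft G f \<chi> = 0}"
proof -
  have "dft G (\<lambda>x. f (g \<otimes> x)) \<chi> = 0"
    if "dft G f \<chi> = 0" and \<chi>: "\<chi> \<in> characters G" and g: "g \<in> carrier G" for f \<chi> g
  proof -
    have "\<chi> g * dft G (\<lambda>x. f (g \<otimes> x)) \<chi> = (\<Sum>x\<in>carrier G. f (g \<otimes> x) * \<chi> (g \<otimes> x))"
      unfolding dft_def sum_distrib_left using g by (intro sum.cong refl) (simp add: char_mult[OF \<chi>])
    also have "\<dots> = dft G f \<chi>" unfolding dft_def by (rule sum_translate[OF g])
    finally show ?thesis using that(1) char_inv[OF \<chi> g] by auto
  qed
  then show ?thesis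
    unfolding translation_invariant_subspace_def
    by (auto simp: dft_def distrib_right sum.distrib mult.assoc simp flip: sum_distrib_left)
qed

lemma dft_eq_0_imp_eq_0:
  assumes "\<And>\<chi>. \<chi> \<in> characters G \<Longrightarrow> dft G f \<chi> = 0" "x \<in> carrier G"
  shows "f x = 0"
proof (rule ccontr)
  assume "f x \<noteq> 0"
  define V where "V = {f. \<forall>\<chi>\<in>characters G. dft G f \<chi> = 0}"
  have "f \<in> V" using assms(1) by (simp add: V_def)
  moreover have "\<exists>x\<in>carrier G. f x \<noteq> 0" using \<open>f x \<noteq> 0\<close> assms(2) by blast
  moreover have "translation_invariant_subspace G V"
    unfolding V_def by (rule translation_invariant_dft_kernel)
  ultimately obtain \<chi> \<psi> where \<chi>: "\<chi> \<in> characters G" and \<psi>: "\<psi> \<in> V" "\<forall>x\<in>carrier G. \<psi> x = \<chi> x"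
    using ex_char_in_invariant_subspace[of V f] by blast
  define \<chi>' where "\<chi>' = (\<lambda>x\<in>carrier G. \<chi> (inv x))"
  have "\<chi>' \<in> characters G"
    using \<chi> by (simp add: \<chi>'_def characters_def inv_mult)
  then have "dft G \<psi> \<chi>' = 0" using \<psi>(1) by (simp add: V_def)
  moreover have "dft G \<psi> \<chi>' = (\<Sum>x\<in>carrier G. \<chi> x * \<chi> (inv x))"
    by (simp add: dft_def \<chi>'_def \<psi>(2))
  ultimately show False
    using char_orthogonality[OF \<chi> \<chi>] order_pos by simp
qed

theorem dft_inversion:
  assumes "x \<in> carrier G"
  shows "of_nat (order G) * f x = (\<Sum>\<chi>\<in>characters G. dft G f \<chi> * \<chi> (inv x))"
proof -
  define g where "g x = of_nat (order G) * f x - (\<Sum>\<chi>\<in>characters G. dft G f \<chi> * \<chi> (inv x))" for x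
  have "dft G g \<eta> = 0" if \<eta>: "\<eta> \<in> characters G" for \<eta>
  proof -
    have "(\<Sum>x\<in>carrier G. (\<Sum>\<chi>\<in>characters G. dft G f \<chi> * \<chi> (inv x)) * \<eta> x) =
        (\<Sum>\<chi>\<in>characters G. dft G f \<chi> * (\<Sum>x\<in>carrier G. \<eta> x * \<chi> (inv x)))"
      unfolding sum_distrib_left sum_distrib_right by (subst sum.swap) (simp add: mult_ac)
    also have "\<dots> = (\<Sum>\<chi>\<in>characters G. if \<chi> = \<eta> then dft G f \<chi> * of_nat (order G) else 0)"
      using \<eta> by (intro sum.cong refl) (auto simp: char_orthogonality)
    also have "\<dots> = of_nat (order G) * dft G f \<eta>"
      using \<eta> finite_characters by simp
    also have "\<dots> = (\<Sum>x\<in>carrier G. of_nat (order G) * f x * \<eta> x)"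
      unfolding dft_def sum_distrib_left by (simp add: mult.assoc)
    finally show ?thesis
      by (simp add: dft_def g_def left_diff_distrib sum_subtractf)
  qed
  then have "g x = 0" using assms by (rule dft_eq_0_imp_eq_0)
  then show ?thesis by (simp add: g_def)
qed

lemma alg_cong_0_if_dft:
  assumes "\<And>\<chi>. \<chi> \<in> characters G \<Longrightarrow> alg_cong m (dft G f \<chi>) 0" "x \<in> carrier G"
  shows "alg_cong m (of_nat (order G) * f x) 0"
proof -
  have "alg_cong m (\<Sum>\<chi>\<in>characters G. dft G f \<chi> * \<chi> (inv x)) (\<Sum>\<chi>\<in>characters G. 0 * \<chi> (inv x))"
    using assms by (intro alg_cong_sum alg_cong_mult_right algebraic_int_char) auto
  then show ?thesis by (simp add: dft_inversion[OF assms(2)])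
qed

lemma translate_quotient:
  assumes "g \<in> carrier G" "u \<in> carrier G" "v \<in> carrier G"
  shows "(g \<otimes> v) \<otimes> inv (g \<otimes> u) = v \<otimes> inv u"
proof -
  have "(g \<otimes> v) \<otimes> inv (g \<otimes> u) = (v \<otimes> g) \<otimes> (inv g \<otimes> inv u)"
    using assms by (simp add: m_comm[of g v] inv_mult)
  also have "\<dots> = v \<otimes> ((g \<otimes> inv g) \<otimes> inv u)"
    using assms by (simp only: m_assoc m_closed inv_closed)
  finally show ?thesis using assms by simp
qed

lemma translation_invariant_group_matrix_eigenspace:
  "translation_invariant_subspace G
     {x. \<forall>u\<in>carrier G. (\<Sum>v\<in>carrier G. f (v \<otimes> inv u) * x v) = c * x u}"
proof -
  have "(\<Sum>v\<in>carrier G. f (v \<otimes> inv u) * x (g \<otimes> v)) = c * x (g \<otimes> u)"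
    if x: "\<forall>u\<in>carrier G. (\<Sum>v\<in>carrier G. f (v \<otimes> inv u) * x v) = c * x u"
      and g: "g \<in> carrier G" and u: "u \<in> carrier G" for x g u
  proof -
    have "(\<Sum>v\<in>carrier G. f (v \<otimes> inv u) * x (g \<otimes> v)) =
        (\<Sum>v\<in>carrier G. f ((g \<otimes> v) \<otimes> inv (g \<otimes> u)) * x (g \<otimes> v))"
      using g u by (simp add: translate_quotient)
    also have "\<dots> = (\<Sum>v\<in>carrier G. f (v \<otimes> inv (g \<otimes> u)) * x v)" by (rule sum_translate[OF g])
    also have "\<dots> = c * x (g \<otimes> u)" using x g u by simp
    finally show ?thesis .
  qed
  then show ?thesis
    unfolding translation_invariant_subspace_def
    by (auto simp: distrib_left sum.distrib mult.left_commute simp flip: sum_distrib_left)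
qed

lemma group_matrix_mult_char:
  assumes \<chi>: "\<chi> \<in> characters G" and u: "u \<in> carrier G"
  shows "(\<Sum>v\<in>carrier G. f (v \<otimes> inv u) * \<chi> v) = dft G f \<chi> * \<chi> u"
proof -
  have "(\<Sum>v\<in>carrier G. f (v \<otimes> inv u) * \<chi> v) =
      (\<Sum>v\<in>carrier G. f ((u \<otimes> v) \<otimes> inv u) * \<chi> (u \<otimes> v))"
    by (rule sum_translate[OF u, symmetric])
  also have "\<dots> = (\<Sum>v\<in>carrier G. f v * \<chi> v * \<chi> u)"
    using u by (intro sum.cong refl) (simp add: char_mult[OF \<chi>] m_comm[of u] m_assoc)
  finally show ?thesis by (simp add: dft_def sum_distrib_right)
qed

theorem eigenvalue_on_group_matrix_iff:
  "eigenvalue_on (carrier G) (\<lambda>u v. f (v \<otimes> inv u)) c \<longleftrightarrow> (\<exists>\<chi>\<in>characters G. c = dft G f \<chi>)"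
proof
  assume "eigenvalue_on (carrier G) (\<lambda>u v. f (v \<otimes> inv u)) c"
  define V where "V = {x. \<forall>u\<in>carrier G. (\<Sum>v\<in>carrier G. f (v \<otimes> inv u) * x v) = c * x u}"
  obtain x where "x \<in> V" "\<exists>u\<in>carrier G. x u \<noteq> 0"
    using \<open>eigenvalue_on _ _ _\<close> unfolding eigenvalue_on_def V_def by blast
  moreover have "translation_invariant_subspace G V"
    unfolding V_def by (rule translation_invariant_group_matrix_eigenspace)
  ultimately obtain \<chi> \<psi> where \<chi>: "\<chi> \<in> characters G" and \<psi>: "\<psi> \<in> V" "\<forall>x\<in>carrier G. \<psi> x = \<chi> x"
    using ex_char_in_invariant_subspace[of V x] by blast
  have "(\<Sum>v\<in>carrier G. f (v \<otimes> inv \<one>) * \<psi> v) = c * \<psi> \<one>"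
    using \<psi>(1) one_closed unfolding V_def by blast
  then have "dft G f \<chi> * \<chi> \<one> = c * \<chi> \<one>"
    unfolding group_matrix_mult_char[OF \<chi> one_closed, symmetric] by (simp add: \<psi>(2))
  then show "\<exists>\<chi>\<in>characters G. c = dft G f \<chi>"
    using \<chi> char_one[OF \<chi>] by (intro bexI[of _ \<chi>]) simp_all
next
  assume "\<exists>\<chi>\<in>characters G. c = dft G f \<chi>"
  then obtain \<chi> where \<chi>: "\<chi> \<in> characters G" "c = dft G f \<chi>" by blast
  have "\<chi> \<one> \<noteq> 0" using char_one[OF \<chi>(1)] by simp
  then show "eigenvalue_on (carrier G) (\<lambda>u v. f (v \<otimes> inv u)) c"
    unfolding eigenvalue_on_def \<chi>(2) using group_matrix_mult_char[OF \<chi>(1)] by blast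
qed

end

section \<open>Integral Fourier transforms\<close>

lemma ex_cong_coprime:
  fixes k m L :: nat
  assumes "coprime k m" "L > 0"
  shows "\<exists>k'. [k' = k] (mod m) \<and> coprime k' L"
  using assms(2)
proof (induction L rule: prime_divisors_induct)
  case zero
  then show ?case by simp
next
  case (unit u)
  then show ?case by (intro exI[of _ k]) (auto intro: is_unit_right_imp_coprime)
next
  case (factor p L)
  then obtain k' where k': "[k' = k] (mod m)" "coprime k' L" by auto
  have "coprime k' m" using assms(1) cong_imp_coprime cong_sym k'(1) by blast
  show ?case
  proof (cases "p dvd k'")
    case True
    have "\<not> p dvd m" "\<not> p dvd L"
      using True \<open>coprime k' m\<close> k'(2) factor.hyps coprime_common_divisor not_prime_unit by blast+
    then have "\<not> p dvd k' + m * L"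
      using True factor.hyps by (simp add: dvd_add_right_iff prime_dvd_mult_iff)
    then have "coprime (k' + m * L) p"
      using factor.hyps prime_imp_coprime coprime_commute by blast
    moreover have "coprime (k' + m * L) L"
      using k'(2) by (metis add.commute gcd_add_mult coprime_iff_gcd_eq_1 gcd.commute)
    moreover have "[k' + m * L = k] (mod m)" using k'(1) by (simp add: cong_def)
    ultimately show ?thesis by (metis coprime_mult_right_iff)
  next
    case False
    then have "coprime k' p" using factor.hyps prime_imp_coprime coprime_commute by blast
    then show ?thesis using k' by (metis coprime_mult_right_iff)
  qed
qed

context finite_comm_group
begin

definition galois_equivariant :: "('a \<Rightarrow> complex) \<Rightarrow> bool" where
  "galois_equivariant f \<longleftrightarrow>
     (\<forall>k. coprime k (3 * order G) \<longrightarrow> (\<forall>x\<in>carrier G. f (x [^] (k::nat)) = galois3 k (f x)))"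

lemma algebraic_int_dft:
  assumes "f ` carrier G \<subseteq> eisenstein_ints" "\<chi> \<in> characters G"
  shows "algebraic_int (dft G f \<chi>)"
  using assms unfolding dft_def
  by (intro algebraic_int_sum algebraic_int_mult algebraic_int_eisenstein algebraic_int_char) auto

lemma dft_eq_if_equivariant_at:
  assumes "coprime k (order G)" "\<And>x. x \<in> carrier G \<Longrightarrow> f (x [^] k) = galois3 k (f x)"
    and "\<chi> \<in> characters G"
  shows "dft G f \<chi> = (\<Sum>x\<in>carrier G. galois3 k (f x) * \<chi> x ^ k)"
proof -
  have "dft G f \<chi> = (\<Sum>x\<in>carrier G. f (x [^] k) * \<chi> (x [^] k))"
    unfolding dft_def by (rule sum_pow[OF assms(1), symmetric])
  then show ?thesis using assms(2,3) by (simp add: char_pow)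
qed

lemma dft_Ints_if_galois_equivariant:
  assumes f: "f ` carrier G \<subseteq> eisenstein_ints" "galois_equivariant f" and \<chi>: "\<chi> \<in> characters G"
  shows "dft G f \<chi> \<in> \<int>"
proof -
  let ?T = "totatives (3 * order G)"
  have dft: "dft G f \<chi> = (\<Sum>x\<in>carrier G. galois3 k (f x) * \<chi> x ^ k)" if "k \<in> ?T" for k
    using that f(2) \<chi> unfolding galois_equivariant_def
    by (intro dft_eq_if_equivariant_at) (auto simp: in_totatives_iff)
  have "of_nat (card ?T) * dft G f \<chi> = (\<Sum>k\<in>?T. dft G f \<chi>)" by simp
  also have "\<dots> = (\<Sum>k\<in>?T. \<Sum>x\<in>carrier G. galois3 k (f x) * \<chi> x ^ k)"
    by (rule sum.cong[OF refl dft])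
  also have "\<dots> = (\<Sum>x\<in>carrier G. \<Sum>k\<in>?T. galois3 k (f x) * \<chi> x ^ k)" by (rule sum.swap)
  also have "\<dots> \<in> \<int>"
    using f(1) char_pow_order[OF \<chi>] order_pos by (intro Ints_sum galois3_trace_Ints) auto
  finally have "of_nat (card ?T) * dft G f \<chi> \<in> \<rat>" using Ints_subset_Rats by blast
  then have "of_nat (card ?T) * dft G f \<chi> / of_nat (card ?T) \<in> \<rat>" by (intro Rats_divide) auto
  moreover have "card ?T \<noteq> 0" using order_pos by (simp flip: totient_def)
  ultimately have "dft G f \<chi> \<in> \<rat>" by simp
  with algebraic_int_dft[OF f(1) \<chi>] show ?thesis by (rule rational_algebraic_int_is_int)
qed

lemma alg_cong_dft_power_prime:
  assumes f: "f ` carrier G \<subseteq> eisenstein_ints" and p: "prime p" "\<not> 3 dvd p" and \<chi>: "\<chi> \<in> characters G"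
  shows "alg_cong p (dft G f \<chi> ^ p) (\<Sum>x\<in>carrier G. galois3 p (f x) * \<chi> x ^ p)"
proof -
  have "alg_cong p (dft G f \<chi> ^ p) (\<Sum>x\<in>carrier G. (f x * \<chi> x) ^ p)"
    unfolding dft_def using f
    by (intro alg_cong_power_prime_sum p(1) algebraic_int_mult algebraic_int_eisenstein
        algebraic_int_char[OF \<chi>]) auto
  also have "(\<Sum>x\<in>carrier G. (f x * \<chi> x) ^ p) = (\<Sum>x\<in>carrier G. f x ^ p * \<chi> x ^ p)"
    by (simp add: power_mult_distrib)
  also have "alg_cong p \<dots> (\<Sum>x\<in>carrier G. galois3 p (f x) * \<chi> x ^ p)"
    using f
    by (intro alg_cong_sum alg_cong_mult_right alg_cong_eisenstein_power_prime p algebraic_int_power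
        algebraic_int_char[OF \<chi>]) auto
  finally show ?thesis .
qed

lemma alg_cong_equivariance_defect:
  assumes f: "f ` carrier G \<subseteq> eisenstein_ints" "\<And>\<chi>. \<chi> \<in> characters G \<Longrightarrow> dft G f \<chi> \<in> \<int>"
    and p: "prime p" "\<not> 3 dvd p" "coprime p (order G)" and x: "x \<in> carrier G"
  shows "alg_cong p (of_nat (order G) * (f (x [^] p) - galois3 p (f x))) 0"
proof -
  obtain l :: nat where l: "\<And>x. x \<in> carrier G \<Longrightarrow> (x [^] p) [^] l = x"
    using ex_pow_inverse[OF p(3)] ord_dvd_group_order by blast
  define h where "h x = f (x [^] p) - galois3 p (f x)" for x
  have "alg_cong p (dft G (\<lambda>y. h (y [^] l)) \<chi>) 0" if \<chi>: "\<chi> \<in> characters G" for \<chi>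
  proof -
    let ?s = "\<Sum>x\<in>carrier G. galois3 p (f x) * \<chi> x ^ p"
    have "dft G (\<lambda>y. h (y [^] l)) \<chi> = (\<Sum>x\<in>carrier G. h ((x [^] p) [^] l) * \<chi> (x [^] p))"
      unfolding dft_def by (rule sum_pow[OF p(3), symmetric])
    also have "\<dots> = (\<Sum>x\<in>carrier G. h x * \<chi> (x [^] p))" using l by simp
    also have "\<dots> = dft G f \<chi> - ?s"
      unfolding dft_def h_def using sum_pow[OF p(3), of "\<lambda>x. f x * \<chi> x"]
      by (simp add: left_diff_distrib sum_subtractf char_pow[OF \<chi>])
    finally have dft: "dft G (\<lambda>y. h (y [^] l)) \<chi> = dft G f \<chi> - ?s" .
    obtain c where c: "dft G f \<chi> = of_int c" using f(2)[OF \<chi>] Ints_cases by blast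
    have "alg_cong p (dft G f \<chi>) (dft G f \<chi> ^ p)"
      unfolding c by (rule alg_cong_sym[OF alg_cong_of_int_power_prime[OF p(1)]])
    also have "alg_cong p \<dots> ?s" by (rule alg_cong_dft_power_prime[OF f(1) p(1,2) \<chi>])
    finally show ?thesis
      unfolding dft by (auto simp: alg_cong_def)
  qed
  then have "alg_cong p (of_nat (order G) * h ((x [^] p) [^] l)) 0"
    using x by (intro alg_cong_0_if_dft[where f = "\<lambda>y. h (y [^] l)"]) auto
  then show ?thesis by (simp add: l x h_def)
qed

lemma equivariant_at_large_primes:
  assumes f: "f ` carrier G \<subseteq> eisenstein_ints" "\<And>\<chi>. \<chi> \<in> characters G \<Longrightarrow> dft G f \<chi> \<in> \<int>"
  obtains B :: nat where
    "\<And>p x. prime p \<Longrightarrow> B < p \<Longrightarrow> coprime p (3 * order G) \<Longrightarrow> x \<in> carrier G \<Longrightarrow>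
       f (x [^] p) = galois3 p (f x)"
proof -
  define M where "M = (\<Sum>y\<in>carrier G. norm (f y))"
  have M: "norm (f y) \<le> M" if "y \<in> carrier G" for y
    unfolding M_def using that finite_carrier by (intro member_le_sum) auto
  obtain B :: nat where B: "real (order G) * (2 * M)\<^sup>2 < real B"
    using reals_Archimedean2 by blast
  have "f (x [^] p) = galois3 p (f x)"
    if p: "prime p" "B < p" "coprime p (3 * order G)" and x: "x \<in> carrier G" for p x
  proof -
    define d where "d = f (x [^] p) - galois3 p (f x)"
    have "alg_cong p (of_nat (order G) * d) 0"
      unfolding d_def using p(3)
      by (intro alg_cong_equivariance_defect f p(1) x) (auto simp: coprime_3_iff)
    moreover have "d \<in> eisenstein_ints"
      unfolding d_def using f(1) x by (intro eisenstein_diff galois3_eisenstein) auto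
    moreover have "norm d \<le> norm (f (x [^] p)) + norm (f x)"
      unfolding d_def using norm_triangle_ineq4[of "f (x [^] p)" "galois3 p (f x)"] by simp
    then have "norm d \<le> 2 * M" using M[of x] M[of "x [^] p"] x by simp
    then have "real (order G) * (norm d)\<^sup>2 \<le> real (order G) * (2 * M)\<^sup>2"
      by (intro mult_left_mono power_mono) auto
    then have "real (order G) * (norm d)\<^sup>2 < real p" using B p(2) by linarith
    ultimately have "d = 0" using order_pos by (intro eisenstein_eq_0_if_alg_cong_0) auto
    then show ?thesis by (simp add: d_def)
  qed
  then show thesis by (rule that)
qed

lemma equivariant_at_if_prime_factors:
  assumes "\<And>p y. prime p \<Longrightarrow> p dvd k \<Longrightarrow> y \<in> carrier G \<Longrightarrow> f (y [^] p) = galois3 p (f y)"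
    and "\<not> 3 dvd k" "x \<in> carrier G"
  shows "f (x [^] (k::nat)) = galois3 k (f x)"
  using assms
proof (induction k arbitrary: x rule: prime_divisors_induct)
  case (factor p k)
  have "\<not> 3 dvd p" "\<not> 3 dvd k" using factor.prems(2) by auto
  moreover from this have "f (x [^] k) = galois3 k (f x)" using factor by simp
  moreover have "f ((x [^] k) [^] p) = galois3 p (f (x [^] k))" using factor by simp
  ultimately show ?case
    using factor.prems(3) by (simp add: nat_pow_pow mult.commute[of k] galois3_mult_exponent)
qed simp_all

lemma galois_equivariant_if_dft_Ints:
  assumes f: "f ` carrier G \<subseteq> eisenstein_ints" "\<And>\<chi>. \<chi> \<in> characters G \<Longrightarrow> dft G f \<chi> \<in> \<int>"
  shows "galois_equivariant f"
  unfolding galois_equivariant_def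
proof (intro allI impI ballI)
  fix k x assume k: "coprime (k::nat) (3 * order G)" and x: "x \<in> carrier G"
  obtain B :: nat where B: "\<And>p y. prime p \<Longrightarrow> B < p \<Longrightarrow> coprime p (3 * order G) \<Longrightarrow> y \<in> carrier G \<Longrightarrow>
      f (y [^] p) = galois3 p (f y)"
    using equivariant_at_large_primes[OF f] by blast
  \<comment> \<open>Only the class of \<open>k\<close> matters, so its prime factors may be assumed to exceed \<open>B\<close>.\<close>
  obtain k' where k': "[k' = k] (mod 3 * order G)" "coprime k' (fact B)"
    using ex_cong_coprime[OF k fact_gt_zero] by blast
  have cop: "coprime k' (3 * order G)" using k k'(1) cong_imp_coprime cong_sym by blast
  have primes: "f (y [^] p) = galois3 p (f y)"
    if p: "prime p" "p dvd k'" and y: "y \<in> carrier G" for p y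
  proof (rule B[OF p(1) _ _ y])
    show "coprime p (3 * order G)" using cop p(2) coprime_divisors dvd_refl by blast
    have "\<not> p dvd fact B" using k'(2) p coprime_common_divisor not_prime_unit by blast
    then show "B < p" using p(1) prime_dvd_fact_iff by (metis not_less)
  qed
  have "\<not> 3 dvd k'" using cop by (simp add: coprime_3_iff)
  have "f (x [^] k') = galois3 k' (f x)"
    by (rule equivariant_at_if_prime_factors) fact+
  moreover have "[k' = k] (mod ord x)" "[k' = k] (mod 3)"
    using k'(1) ord_dvd_group_order[OF x] by (auto intro: cong_dvd_modulus_nat)
  ultimately show "f (x [^] k) = galois3 k (f x)"
    using pow_cong_ord[OF x] galois3_cong by metis
qed

theorem dft_Ints_iff_galois_equivariant:
  assumes "f ` carrier G \<subseteq> eisenstein_ints"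
  shows "(\<forall>\<chi>\<in>characters G. dft G f \<chi> \<in> \<int>) \<longleftrightarrow> galois_equivariant f"
  using dft_Ints_if_galois_equivariant galois_equivariant_if_dft_Ints assms by blast

lemma galois_equivariant_pow:
  assumes f: "galois_equivariant f" and x: "x \<in> carrier G" and k: "coprime k (ord x)" "\<not> 3 dvd k"
  shows "f (x [^] (k::nat)) = galois3 k (f x)"
proof -
  have "coprime k (3 * ord x)" using k by (simp add: coprime_3_iff)
  then obtain k' where k': "[k' = k] (mod 3 * ord x)" "coprime k' (3 * order G)"
    using ex_cong_coprime[of k "3 * ord x" "3 * order G"] order_pos by auto
  then have "[k' = k] (mod 3)" "[k' = k] (mod ord x)"
    by (auto intro: cong_dvd_modulus_nat)
  then show ?thesis
    using f k'(2) x pow_cong_ord[OF x] galois3_cong unfolding galois_equivariant_def by metis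
qed

lemma galois_equivariant_pow_if_real:
  assumes f: "galois_equivariant f" and x: "x \<in> carrier G" "f x \<in> \<real>" and k: "coprime k (ord x)"
  shows "f (x [^] (k::nat)) = f x"
proof -
  obtain k' where k': "[k' = k] (mod ord x)" "coprime k' (3 * order G)"
    using ex_cong_coprime[OF k, of "3 * order G"] order_pos by auto
  then have "f (x [^] k') = f x"
    using f x unfolding galois_equivariant_def by (simp add: galois3_real)
  then show ?thesis using pow_cong_ord[OF x(1) k'(1)] by simp
qed

lemma galois_equivariant_if_pow_1_mod_3:
  assumes inv: "\<And>x. x \<in> carrier G \<Longrightarrow> f (inv x) = cnj (f x)"
    and pow: "\<And>x k. x \<in> carrier G \<Longrightarrow> coprime k (order G) \<Longrightarrow> [k = 1] (mod 3) \<Longrightarrow> f (x [^] (k::nat)) = f x"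
  shows "galois_equivariant f"
  unfolding galois_equivariant_def
proof (intro allI impI ballI)
  fix k x assume "coprime (k::nat) (3 * order G)" and x: "x \<in> carrier G"
  then have k: "\<not> 3 dvd k" "coprime k (order G)" by (simp_all add: coprime_3_iff)
  from k(1) show "f (x [^] k) = galois3 k (f x)"
  proof (cases rule: not_3_dvd_cases)
    case 1
    then show ?thesis using pow[OF x k(2)] by (simp add: galois3_def)
  next
    case 2
    define l where "l = k * (3 * order G - 1)"
    have "coprime (3 * order G - 1) (3 * order G)"
      using order_pos by (intro coprime_diff_one_left_nat) simp
    then have "coprime l (order G)" using k(2) by (simp add: l_def)
    moreover have "l + k = 3 * (k * order G)" using order_pos by (simp add: l_def algebra_simps)
    then have "(l + k) mod 3 = 0" by simp
    then have "[l = 1] (mod 3)" using 2 unfolding cong_def by presburger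
    ultimately have "f (x [^] l) = f x" using pow[OF x] by blast
    moreover have "x [^] l = inv (x [^] k)"
      unfolding l_def using x order_pos
      by (intro pow_neg_exponent) (auto simp: ord_dvd_group_order)
    ultimately have "cnj (f (x [^] k)) = f x" using inv[of "x [^] k"] x by simp
    then have "f (x [^] k) = cnj (f x)" by (metis complex_cnj_cnj)
    then show ?thesis using 2 by (simp add: galois3_def cong_def)
  qed
qed

end

section \<open>The Boolean algebra generated by the subgroups\<close>

context finite_group
begin

lemma Union_in_subgroup_algebra:
  assumes "finite F" "F \<subseteq> subgroup_algebra G"
  shows "\<Union>F \<in> subgroup_algebra G"
  using assms
proof (induction F)
  case empty
  have "carrier G - carrier G \<in> subgroup_algebra G"
    by (intro subgroup_algebra.compl subgroup_algebra.subgroup subgroup_self)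
  then show ?case by simp
next
  case (insert A F)
  then show ?case by (simp add: subgroup_algebra.union)
qed

lemma generate_singleton_in_subgroup_algebra:
  "x \<in> carrier G \<Longrightarrow> generate G {x} \<in> subgroup_algebra G"
  by (intro subgroup_algebra.subgroup generate_is_subgroup) simp

lemma subgroup_algebra_subset_carrier: "A \<in> subgroup_algebra G \<Longrightarrow> A \<subseteq> carrier G"
  by (induction rule: subgroup_algebra.induct) (auto dest: subgroup.subset)

lemma subgroup_algebra_pow_mem_iff:
  assumes "A \<in> subgroup_algebra G" "x \<in> carrier G" "coprime k (ord x)"
  shows "x [^] (k::nat) \<in> A \<longleftrightarrow> x \<in> A"
  using assms(1)
proof (induction A)
  case (subgroup H)
  have pow_closed: "y [^] (n::nat) \<in> H" if "y \<in> H" for y n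
    using that
    by (induction n) (auto intro: subgroup.m_closed[OF subgroup] subgroup.one_closed[OF subgroup])
  obtain l :: nat where "(x [^] k) [^] l = x"
    using ex_pow_inverse[OF assms(3)] assms(2) dvd_refl by blast
  then show ?case using pow_closed by metis
qed (use assms(2) in auto)

definition generator_class :: "'a \<Rightarrow> 'a set" where
  "generator_class x = {y \<in> carrier G. generate G {y} = generate G {x}}"

lemma generate_singleton_subset_iff:
  assumes "x \<in> carrier G" "y \<in> carrier G"
  shows "generate G {y} \<subseteq> generate G {x} \<longleftrightarrow> y \<in> generate G {x}"
  using assms generate.incl[of y "{y}"] generate_subgroup_incl[of "{y}" "generate G {x}"]
    generate_is_subgroup[of "{x}"]
  by auto

lemma generator_class_in_subgroup_algebra:
  assumes x: "x \<in> carrier G"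
  shows "generator_class x \<in> subgroup_algebra G"
proof -
  define Y where "Y = {y \<in> generate G {x}. x \<notin> generate G {y}}"
  have sub: "generate G {x} \<subseteq> carrier G" using x by (intro generate_incl) simp
  then have Y: "finite Y" "Y \<subseteq> carrier G"
    using finite_carrier by (auto simp: Y_def intro: finite_subset)
  then have "\<Union> ((\<lambda>y. generate G {y}) ` Y) \<in> subgroup_algebra G"
    by (intro Union_in_subgroup_algebra) (auto intro: generate_singleton_in_subgroup_algebra)
  then have "generate G {x} \<inter> (carrier G - \<Union> ((\<lambda>y. generate G {y}) ` Y)) \<in> subgroup_algebra G"
    by (intro subgroup_algebra.inter subgroup_algebra.compl generate_singleton_in_subgroup_algebra x)
  moreover have "generator_class x = generate G {x} \<inter> (carrier G - \<Union> ((\<lambda>y. generate G {y}) ` Y))"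
  proof (intro subset_antisym subsetI)
    fix z assume "z \<in> generator_class x"
    then have z: "z \<in> carrier G" "generate G {z} = generate G {x}" by (auto simp: generator_class_def)
    then have "z \<in> generate G {x}" "x \<in> generate G {z}" using x generate_singleton_subset_iff by blast+
    then show "z \<in> generate G {x} \<inter> (carrier G - \<Union> ((\<lambda>y. generate G {y}) ` Y))"
      using z(1) Y generate_singleton_subset_iff x z(2) unfolding Y_def by blast
  next
    fix z assume z: "z \<in> generate G {x} \<inter> (carrier G - \<Union> ((\<lambda>y. generate G {y}) ` Y))"
    then have "z \<in> generate G {z}" by (intro generate.incl) simp
    then have "x \<in> generate G {z}" using z unfolding Y_def by blast
    then show "z \<in> generator_class x"
      using z x generate_singleton_subset_iff unfolding generator_class_def by blast
  qed
  ultimately show ?thesis by simp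
qed

lemma generator_class_imp_coprime_pow:
  assumes x: "x \<in> carrier G" and "y \<in> generator_class x"
  obtains k :: nat where "coprime k (ord x)" "y = x [^] k"
proof -
  have y: "y \<in> carrier G" "generate G {y} = generate G {x}"
    using assms(2) by (auto simp: generator_class_def)
  then have "y \<in> generate G {x}" using generate_singleton_subset_iff[OF x y(1)] by simp
  then obtain k :: nat where k: "y = x [^] k"
    using generate_pow_on_finite_carrier[OF finite_carrier x] by blast
  have "ord y = ord x" using generate_pow_card x y by metis
  then have "coprime k (ord x)" using ord_pow_eq_ord_iff[OF x ord_pos[OF x]] k by simp
  then show thesis using k that by blast
qed

theorem subgroup_algebra_iff_pow_closed:
  "A \<in> subgroup_algebra G \<longleftrightarrow>
     A \<subseteq> carrier G \<and> (\<forall>x\<in>A. \<forall>k::nat. coprime k (ord x) \<longrightarrow> x [^] k \<in> A)"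
proof
  assume "A \<in> subgroup_algebra G"
  then show "A \<subseteq> carrier G \<and> (\<forall>x\<in>A. \<forall>k::nat. coprime k (ord x) \<longrightarrow> x [^] k \<in> A)"
    using subgroup_algebra_subset_carrier subgroup_algebra_pow_mem_iff by blast
next
  assume A: "A \<subseteq> carrier G \<and> (\<forall>x\<in>A. \<forall>k::nat. coprime k (ord x) \<longrightarrow> x [^] k \<in> A)"
  have "y \<in> A" if x: "x \<in> A" and y: "y \<in> generator_class x" for x y
  proof -
    have "x \<in> carrier G" using A x by blast
    then obtain k :: nat where "coprime k (ord x)" "y = x [^] k"
      using generator_class_imp_coprime_pow[OF _ y] by metis
    then show ?thesis using A x by blast
  qed
  then have "\<Union> (generator_class ` A) \<subseteq> A" by blast
  moreover have "A \<subseteq> \<Union> (generator_class ` A)"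
    using A by (auto simp: generator_class_def)
  ultimately have "A = \<Union> (generator_class ` A)" by blast
  also have "\<dots> \<in> subgroup_algebra G"
    using A finite_subset[OF _ finite_carrier] generator_class_in_subgroup_algebra
    by (intro Union_in_subgroup_algebra) auto
  finally show "A \<in> subgroup_algebra G" .
qed

end

section \<open>Skew-symmetric unions of classes\<close>

context finite_group
begin

lemma class3_eq:
  assumes "x \<in> elements_order_dvd3 G"
  shows "class3 G x = {x [^] k |k. coprime k (ord x) \<and> [k = 1] (mod 3)}"
proof (intro subset_antisym subsetI)
  fix y assume "y \<in> class3 G x"
  then obtain k where "y = x [^] k" "k \<in> units_1_mod_3 (ord x)" unfolding class3_def by blast
  moreover from this have "coprime k (ord x)" "[k = 1] (mod 3)"
    unfolding units_1_mod_3_def coprime_iff_gcd_eq_1 by blast+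
  ultimately show "y \<in> {x [^] k |k. coprime k (ord x) \<and> [k = 1] (mod 3)}" by blast
next
  fix y assume "y \<in> {x [^] k |k. coprime k (ord x) \<and> [k = 1] (mod 3)}"
  then obtain k where k: "y = x [^] k" "coprime k (ord x)" "[k = 1] (mod 3)" by blast
  have x: "x \<in> carrier G" "3 dvd ord x" using assms by (auto simp: elements_order_dvd3_def)
  define j where "j = k mod ord x"
  have "[j = 1] (mod 3)"
    using k(3) x(2) by (simp add: j_def cong_def mod_mod_cancel)
  moreover from this have "1 \<le> j" by (cases "j = 0") (auto simp: cong_def)
  moreover have "j < ord x" using ord_pos[OF x(1)] by (simp add: j_def)
  then have "j \<le> ord x - 1" by linarith
  moreover have "coprime j (ord x)" using k(2) ord_pos[OF x(1)] by (simp add: j_def)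
  ultimately have "j \<in> units_1_mod_3 (ord x)"
    unfolding units_1_mod_3_def coprime_iff_gcd_eq_1 by blast
  moreover have "y = x [^] j"
    unfolding k(1) by (rule pow_cong_ord[OF x(1)]) (simp add: j_def cong_def)
  ultimately show "y \<in> class3 G x" unfolding class3_def by blast
qed

lemma class3_self:
  assumes "x \<in> elements_order_dvd3 G"
  shows "x \<in> class3 G x"
proof -
  have "x = x [^] (1::nat)" using assms by (simp add: elements_order_dvd3_def)
  then show ?thesis
    unfolding class3_eq[OF assms] by (intro CollectI exI[of _ 1]) simp
qed

lemma class3_pow_closed:
  assumes x: "x \<in> elements_order_dvd3 G" and "y \<in> class3 G x"
  shows "y \<in> elements_order_dvd3 G"
    and "\<And>k. coprime k (ord y) \<Longrightarrow> [k = 1] (mod 3) \<Longrightarrow> y [^] (k::nat) \<in> class3 G x"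
proof -
  have xc: "x \<in> carrier G" "3 dvd ord x" using x by (auto simp: elements_order_dvd3_def)
  obtain j where j: "y = x [^] j" "coprime j (ord x)" "[j = 1] (mod 3)"
    using assms(2) unfolding class3_eq[OF x] by blast
  have ord_y: "ord y = ord x" using j(1,2) ord_pow_eq_ord_iff[OF xc(1) ord_pos[OF xc(1)]] by simp
  then show "y \<in> elements_order_dvd3 G" using xc j(1) by (simp add: elements_order_dvd3_def)
  fix k :: nat assume "coprime k (ord y)" "[k = 1] (mod 3)"
  then have "coprime (j * k) (ord x)" "[j * k = 1] (mod 3)"
    using j(2) ord_y cong_mult[OF j(3), of k 1] by simp_all
  moreover have "y [^] k = x [^] (j * k)" using xc(1) by (simp add: j(1) nat_pow_pow)
  ultimately show "y [^] k \<in> class3 G x" unfolding class3_eq[OF x] by blast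
qed

lemma skew_class_unions_iff:
  "A \<in> skew_class_unions G \<longleftrightarrow>
     skew_symmetric G A \<and> (\<exists>X. finite X \<and> X \<subseteq> elements_order_dvd3 G \<and> A = (\<Union>x\<in>X. class3 G x))"
  by (auto simp: skew_class_unions_def skew_symmetric_def)

theorem skew_class_unions_iff_pow_closed:
  "A \<in> skew_class_unions G \<longleftrightarrow>
     skew_symmetric G A \<and> A \<subseteq> elements_order_dvd3 G \<and>
     (\<forall>x\<in>A. \<forall>k::nat. coprime k (ord x) \<longrightarrow> [k = 1] (mod 3) \<longrightarrow> x [^] k \<in> A)"
proof
  assume "A \<in> skew_class_unions G"
  then obtain X where X: "skew_symmetric G A" "X \<subseteq> elements_order_dvd3 G" "A = (\<Union>x\<in>X. class3 G x)"
    by (auto simp: skew_class_unions_iff)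
  have "A \<subseteq> elements_order_dvd3 G" using class3_pow_closed(1) X(2,3) by blast
  moreover have "y [^] k \<in> A" if "y \<in> A" "coprime k (ord y)" "[k = 1] (mod 3)" for y and k :: nat
    using class3_pow_closed(2)[OF _ _ that(2,3)] that(1) X(2,3) by blast
  ultimately show "skew_symmetric G A \<and> A \<subseteq> elements_order_dvd3 G \<and>
     (\<forall>x\<in>A. \<forall>k::nat. coprime k (ord x) \<longrightarrow> [k = 1] (mod 3) \<longrightarrow> x [^] k \<in> A)"
    using X(1) by blast
next
  assume A: "skew_symmetric G A \<and> A \<subseteq> elements_order_dvd3 G \<and>
     (\<forall>x\<in>A. \<forall>k::nat. coprime k (ord x) \<longrightarrow> [k = 1] (mod 3) \<longrightarrow> x [^] k \<in> A)"
  have "class3 G x \<subseteq> A" if "x \<in> A" for x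
  proof -
    have "x \<in> elements_order_dvd3 G" using A that by blast
    then show ?thesis using A that class3_eq by auto
  qed
  moreover have "x \<in> class3 G x" if "x \<in> A" for x
    using A that class3_self by blast
  ultimately have "A = (\<Union>x\<in>A. class3 G x)" by blast
  moreover have "finite A"
    using A finite_carrier by (auto simp: elements_order_dvd3_def intro: finite_subset)
  ultimately show "A \<in> skew_class_unions G"
    using A unfolding skew_class_unions_iff by blast
qed

end

section \<open>Mixed Cayley graphs\<close>

definition cayley_weight :: "('a, 'b) monoid_scheme \<Rightarrow> 'a set \<Rightarrow> 'a \<Rightarrow> complex" where
  "cayley_weight G S x =
     (if x \<in> S then if inv\<^bsub>G\<^esub> x \<in> S then 1 else 1 + omega
      else if inv\<^bsub>G\<^esub> x \<in> S then cnj (1 + omega) else 0)"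

lemma cayley_weight_eq_1_iff: "cayley_weight G S x = 1 \<longleftrightarrow> x \<in> S - skew_part G S"
  by (auto simp: cayley_weight_def skew_part_def omega_def complex_eq_iff)

lemma cayley_weight_eq_1_plus_omega_iff: "cayley_weight G S x = 1 + omega \<longleftrightarrow> x \<in> skew_part G S"
  by (auto simp: cayley_weight_def skew_part_def omega_def complex_eq_iff)

lemma cayley_weight_in_eisenstein_ints: "cayley_weight G S x \<in> eisenstein_ints"
  using eisenstein_intsI[of 0 0] eisenstein_intsI[of 1 0] eisenstein_intsI[of 1 1]
    cnj_eisenstein[OF eisenstein_intsI[of 1 1]]
  by (simp add: cayley_weight_def)

context finite_comm_group
begin

lemma cayley_weight_inv: "x \<in> carrier G \<Longrightarrow> cayley_weight G S (inv x) = cnj (cayley_weight G S x)"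
  by (simp add: cayley_weight_def)

lemma hermitian_adjacency2_cayley:
  assumes "u \<in> carrier G" "v \<in> carrier G"
  shows "hermitian_adjacency2 (cayley_mixed_graph G S) u v = cayley_weight G S (v \<otimes> inv u)"
proof -
  have "inv (v \<otimes> inv u) = u \<otimes> inv v" using assms by (simp add: inv_mult_group)
  moreover have "(1 + \<i> * complex_of_real (sqrt 3)) / 2 = 1 + omega"
    "(1 - \<i> * complex_of_real (sqrt 3)) / 2 = cnj (1 + omega)"
    by (simp_all add: omega_def complex_eq_iff)
  ultimately show ?thesis
    using assms unfolding hermitian_adjacency2_def cayley_mixed_graph_def cayley_weight_def by simp
qed

theorem HS_integral_cayley_iff_galois_equivariant:
  "HS_integral (cayley_mixed_graph G S) \<longleftrightarrow> galois_equivariant (cayley_weight G S)"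
proof -
  let ?D = "cayley_mixed_graph G S"
  have "pverts ?D = carrier G" by (simp add: cayley_mixed_graph_def)
  then have "eigenvalue_on (pverts ?D) (hermitian_adjacency2 ?D) c \<longleftrightarrow>
      (\<exists>\<chi>\<in>characters G. c = dft G (cayley_weight G S) \<chi>)" for c
    unfolding eigenvalue_on_group_matrix_iff[symmetric]
    by (simp add: eigenvalue_on_def hermitian_adjacency2_cayley)
  then have "HS_integral ?D \<longleftrightarrow> (\<forall>\<chi>\<in>characters G. dft G (cayley_weight G S) \<chi> \<in> \<int>)"
    by (auto simp: HS_integral_def)
  also have "\<dots> \<longleftrightarrow> galois_equivariant (cayley_weight G S)"
    by (rule dft_Ints_iff_galois_equivariant) (auto simp: cayley_weight_in_eisenstein_ints)
  finally show ?thesis .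
qed

lemma symmetric_part_in_subgroup_algebra:
  assumes "galois_equivariant (cayley_weight G S)" "S \<subseteq> carrier G"
  shows "S - skew_part G S \<in> subgroup_algebra G"
  unfolding subgroup_algebra_iff_pow_closed
proof (intro conjI ballI allI impI)
  show "S - skew_part G S \<subseteq> carrier G" using assms(2) by blast
  fix x k assume x: "x \<in> S - skew_part G S" and k: "coprime (k::nat) (ord x)"
  have "cayley_weight G S x = 1" using x by (simp only: cayley_weight_eq_1_iff)
  then have "cayley_weight G S (x [^] k) = 1"
    using galois_equivariant_pow_if_real[OF assms(1) _ _ k] x assms(2) by auto
  then show "x [^] k \<in> S - skew_part G S" by (simp only: cayley_weight_eq_1_iff)
qed

lemma pow_mem_skew_part_if_equivariant:
  assumes "galois_equivariant (cayley_weight G S)" "S \<subseteq> carrier G"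
    and x: "x \<in> skew_part G S" and k: "coprime k (ord x)" "[k = 1] (mod 3)"
  shows "x [^] (k::nat) \<in> skew_part G S"
proof -
  have "\<not> 3 dvd k" using k(2) by (auto simp: cong_def)
  moreover have "x \<in> carrier G" using x assms(2) by (auto simp: skew_part_def)
  ultimately have "cayley_weight G S (x [^] k) = cayley_weight G S x"
    using galois_equivariant_pow[OF assms(1) _ k(1)] k(2) by (simp add: galois3_def)
  then show ?thesis using x by (simp flip: cayley_weight_eq_1_plus_omega_iff)
qed

lemma dvd_ord_if_mem_skew_part:
  assumes "galois_equivariant (cayley_weight G S)" "S \<subseteq> carrier G" and x: "x \<in> skew_part G S"
  shows "3 dvd ord x"
proof (rule ccontr)
  assume "\<not> 3 dvd ord x"
  then have "coprime (ord x) 3" by (simp add: coprime_3_iff)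
  then obtain k where k: "[k = ord x - 1] (mod ord x)" "[k = 1] (mod 3)"
    using binary_chinese_remainder_nat by blast
  have xc: "x \<in> carrier G" using x assms(2) by (auto simp: skew_part_def)
  have "coprime (ord x - 1) (ord x)"
    using ord_pos[OF xc] by (rule coprime_diff_one_left_nat)
  then have "coprime k (ord x)" using k(1) cong_imp_coprime cong_sym by blast
  then have "x [^] k \<in> skew_part G S"
    using pow_mem_skew_part_if_equivariant[OF assms] k(2) by blast
  moreover have "x [^] k = inv x"
    using pow_cong_ord[OF xc k(1)] pow_neg_exponent[OF xc dvd_refl ord_pos[OF xc], of 1] xc by simp
  ultimately show False using x by (simp add: skew_part_def)
qed

lemma skew_part_in_skew_class_unions:
  assumes "galois_equivariant (cayley_weight G S)" "S \<subseteq> carrier G"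
  shows "skew_part G S \<in> skew_class_unions G"
  unfolding skew_class_unions_iff_pow_closed
proof (intro conjI ballI allI impI)
  show "skew_symmetric G (skew_part G S)" by (auto simp: skew_symmetric_def skew_part_def)
  show "skew_part G S \<subseteq> elements_order_dvd3 G"
    using dvd_ord_if_mem_skew_part[OF assms] assms(2)
    by (auto simp: elements_order_dvd3_def skew_part_def)
qed (rule pow_mem_skew_part_if_equivariant[OF assms])

lemma galois_equivariant_if_parts:
  assumes S: "S \<subseteq> carrier G" and sym: "S - skew_part G S \<in> subgroup_algebra G"
    and skew: "skew_part G S \<in> skew_class_unions G"
  shows "galois_equivariant (cayley_weight G S)"
proof (rule galois_equivariant_if_pow_1_mod_3)
  fix x and k :: nat
  assume x: "x \<in> carrier G" and k: "coprime k (order G)" "[k = 1] (mod 3)"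
  have coprime_ord: "coprime k (ord y)" if "y \<in> carrier G" for y
    using k(1) ord_dvd_group_order[OF that] coprime_divisors dvd_refl by blast
  have "y [^] k \<in> S" if "y \<in> S" for y
  proof (cases "y \<in> skew_part G S")
    case True
    then have "y [^] k \<in> skew_part G S"
      using skew k(2) coprime_ord S that unfolding skew_class_unions_iff_pow_closed by blast
    then show ?thesis by (simp add: skew_part_def)
  next
    case False
    then show ?thesis
      using sym coprime_ord S that unfolding subgroup_algebra_iff_pow_closed by blast
  qed
  then have "y [^] k \<in> S \<longleftrightarrow> y \<in> S" if "y \<in> carrier G" for y
    using pow_mem_iff[OF k(1) S _ that] by blast
  then show "cayley_weight G S (x [^] k) = cayley_weight G S x"
    using x by (simp add: cayley_weight_def nat_pow_inv[symmetric])
qed (rule cayley_weight_inv)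

end

theorem theorem4p7:
  fixes G :: "('a, 'b) monoid_scheme" and S :: "'a set"
  assumes "comm_group G"
    and "finite (carrier G)"
    and "S \<subseteq> carrier G"
    and "\<one>\<^bsub>G\<^esub> \<notin> S"
  shows "HS_integral (cayley_mixed_graph G S) \<longleftrightarrow>
    S - skew_part G S \<in> subgroup_algebra G \<and> skew_part G S \<in> skew_class_unions G"
proof -
  interpret comm_group G by fact
  interpret finite_comm_group G by unfold_locales fact
  show ?thesis
    unfolding HS_integral_cayley_iff_galois_equivariant
    using symmetric_part_in_subgroup_algebra skew_part_in_skew_class_unions
      galois_equivariant_if_parts assms(3)
    by blast
qed

end
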